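(* Let $\mathcal{G}$ be a (non-degenerate) $[n,k,d]_q$ A$^s$MDS code with $1<s<q-1$ and such that it is not the case that both $s+1$ and $q$ are powers of $2$. If $k>(s-1)(q+1)-1$ and $n>s(q+1)+k-3$, then the dual code $\mathcal{G}^\perp$ is an A$^s$MDS code, so $\mathcal{G}$ is an N$^s$MDS code.
   Context: A linear $[n,k,d]_q$ code is identified with a projective system: a finite multiset $\mathcal{G}$ of $n$ points (counted with multiplicity) of $\mathrm{PG}(k-1,q)$, not all lying in one hyperplane, with $n-d=\max_H|\mathcal{G}\cap H|$ over hyperplanes $H$ (counted with multiplicity); equivalently, the columns of a generator matrix of a non-degenerate linear code $C\subseteq\mathbb{F}_q^n$ of dimension $k$ and minimum distance $d$. The Singleton defect is $S(\mathcal{G})=n-k+1-d$; $\mathcal{G}$ is A$^s$MDS if $S(\mathcal{G})=s$. The dual code $\mathcal{G}^\perp$ is $C^\perp$, of length $n$ and dimension $n-k$. $\mathcal{G}$ is N$^s$MDS if both $\mathcal{G}$ and $\mathcal{G}^\perp$ are A$^s$MDS. *)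

theory Defs
  imports "HOL-Analysis.Cartesian_Space"
begin

definition hamming_distance :: "'a ^ 'n \<Rightarrow> 'a ^ 'n \<Rightarrow> nat" where
  "hamming_distance x y = card {i. x $ i \<noteq> y $ i}"

text \<open>Only meaningful for a code with at least two codewords; this is guaranteed by
  \<open>nkd_code\<close> below.\<close>

definition min_distance :: "('a ^ 'n) set \<Rightarrow> nat" where
  "min_distance C = Min {hamming_distance x y | x y. x \<in> C \<and> y \<in> C \<and> x \<noteq> y}"

text \<open>No coordinate vanishes on the whole code, i.e. no column of a generator matrix is zero, so
  that the columns represent points of a projective space.\<close>

definition nondegenerate :: "('a::field ^ 'n) set \<Rightarrow> bool" where
  "nondegenerate C \<longleftrightarrow> (\<forall>i. \<exists>x\<in>C. x $ i \<noteq> 0)"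

text \<open>Codes are identified with projective systems, hence non-degeneracy is part of the notion.
  The order \<open>q\<close> of the field is \<open>CARD('a)\<close>.\<close>

definition nkd_code :: "nat \<Rightarrow> nat \<Rightarrow> nat \<Rightarrow> ('a::{field,finite} ^ 'n) set \<Rightarrow> bool" where
  "nkd_code n k d C \<longleftrightarrow> vec.subspace C \<and> nondegenerate C \<and>
     CARD('n) = n \<and> vec.dim C = k \<and> 0 < k \<and> min_distance C = d"

definition dual_code :: "('a::field ^ 'n) set \<Rightarrow> ('a ^ 'n) set" where
  "dual_code C = {y. \<forall>x\<in>C. (\<Sum>i\<in>UNIV. x $ i * y $ i) = 0}"

definition AsMDS :: "nat \<Rightarrow> ('a::{field,finite} ^ 'n) set \<Rightarrow> bool" where
  "AsMDS s C \<longleftrightarrow> (\<exists>n k d. nkd_code n k d C \<and> int n - int k + 1 - int d = int s)"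

definition NsMDS :: "nat \<Rightarrow> ('a::{field,finite} ^ 'n) set \<Rightarrow> bool" where
  "NsMDS s C \<longleftrightarrow> AsMDS s C \<and> AsMDS s (dual_code C)"

end

theory Submission
  imports Defs "HOL-Algebra.Algebraic_Closure_Type" "HOL-Algebra.Sylow" "HOL-Algebra.Multiplicative_Group"
begin

text \<open>
  A nonzero dual word of weight \<open>w\<close> is a dependency among \<open>w\<close> columns of a generator matrix, so the
  words of \<open>C\<close> vanishing on a set \<open>Z\<close> containing its support form a subcode of dimension at least
  \<open>k - |Z| + 1\<close>.

  For \<open>|Z| = k - 1\<close> this subcode contains a pencil of \<open>q + 1\<close> words up to scalars, whose zeros cover
  all other coordinates. Applied to the dual code, this count shows that the dual distance is at most
  \<open>k + 1 - s\<close>.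

  For \<open>|Z| = k - 2\<close> the subcode contains three independent words, whose values at the remaining
  \<open>n - k + 2 \<ge> s (q + 1)\<close> coordinates are points of the plane over \<open>GF(q)\<close> with at most \<open>s + 1\<close> on
  every line. Such a set is a maximal arc of degree \<open>s + 1\<close> or a maximal arc with one point removed.
  Then \<open>s + 1\<close> divides \<open>q\<close>, so \<open>q\<close> is odd, and maximal arcs do not exist by the theorem of Ball,
  Blokhuis and Mazzocca. Hence the dual distance is at least \<open>k - 1\<close>, which is at least \<open>k + 1 - s\<close>.

  The nonexistence of maximal arcs follows the argument of Ball and Blokhuis. Identify the affine plane
  with \<open>GF(q\<^sup>2)\<close>, let \<open>B\<close> be an arc of degree \<open>n\<close>, and let \<open>c\<close> be the coefficient of \<open>T ^ n\<close> in
  \<open>\<Prod>b\<in>B. 1 - (X - b) ^ (q - 1) * T\<close>. The derivative of \<open>(\<Prod>b\<in>B. X - b) * c\<close> vanishes on \<open>GF(q\<^sup>2)\<close>,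
  hence identically, so each \<open>b \<in> B\<close> is a root of order divisible by the characteristic, which the
  degree does not allow.
\<close>

section \<open>Polynomials whose coefficients are polynomials\<close>

lemma coeff_linear_mult:
  fixes p :: "'a::comm_ring_1 poly"
  shows "coeff ([:1, a:] * p) k = coeff p k + (case k of 0 \<Rightarrow> 0 | Suc j \<Rightarrow> a * coeff p j)"
  by (simp add: coeff_pCons split: nat.split)

text \<open>These products are polynomials in an outer variable \<open>T\<close> whose coefficients
  are polynomials in \<open>X\<close>. Putting \<open>X = x\<close> is a ring homomorphism on the
  coefficients, so it commutes with taking the coefficient of \<open>T ^ k\<close>.\<close>

lemma poly_coeff_prod_linear:
  fixes u :: "'i \<Rightarrow> 'a::comm_ring_1 poly"
  assumes "finite A"
  shows "poly (coeff (\<Prod>b\<in>A. [:1, u b:]) k) x = coeff (\<Prod>b\<in>A. [:1, poly (u b) x:]) k"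
  using assms
proof (induction A arbitrary: k rule: finite_induct)
  case (insert a A)
  then show ?case
    unfolding prod.insert[OF insert(1,2)] coeff_linear_mult by (simp split: nat.split)
qed (simp add: coeff_1)

text \<open>The coefficient of \<open>T ^ k\<close> is the \<open>k\<close>-th elementary symmetric
  polynomial of the \<open>u b\<close>, a sum of products of \<open>k\<close> of them.\<close>

lemma degree_coeff_prod_linear:
  fixes u :: "'i \<Rightarrow> 'a::comm_ring_1 poly"
  assumes "finite A" "\<And>b. b \<in> A \<Longrightarrow> degree (u b) \<le> D"
  shows "degree (coeff (\<Prod>b\<in>A. [:1, u b:]) k) \<le> k * D"
  using assms
proof (induction A arbitrary: k rule: finite_induct)
  case (insert a A)
  have "degree (u a * coeff (\<Prod>b\<in>A. [:1, u b:]) j) \<le> D + j * D" for j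
    using insert by (intro order_trans[OF degree_mult_le] add_mono) auto
  moreover have "degree (coeff (\<Prod>b\<in>A. [:1, u b:]) k) \<le> k * D" for k
    using insert by simp
  ultimately show ?case
    unfolding prod.insert[OF insert(1,2)] coeff_linear_mult
    by (intro degree_add_le) (auto split: nat.split)
qed (simp add: coeff_1)

lemma coeff_mult_at_degree_bounds:
  assumes "degree p \<le> m" "degree q \<le> n"
  shows "coeff (p * q) (m + n) = coeff p m * coeff q n"
proof (cases "degree p = m \<and> degree q = n")
  case True
  then show ?thesis using coeff_mult_degree_sum by blast
next
  case False
  then have "degree (p * q) < m + n"
    using assms degree_mult_le[of p q] by linarith
  moreover have "coeff p m = 0 \<or> coeff q n = 0"
    using False assms by (auto intro: coeff_eq_0)
  ultimately show ?thesis by (auto intro: coeff_eq_0)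
qed

text \<open>In a product of \<open>k\<close> of the \<open>u b\<close>, exponent
  \<open>k * D\<close> is reached only by multiplying the coefficients at \<open>D\<close>, so the
  elementary symmetric polynomial can be evaluated on these coefficients.\<close>

lemma lead_coeff_prod_linear:
  fixes u :: "'i \<Rightarrow> 'a::comm_ring_1 poly"
  assumes "finite A" "\<And>b. b \<in> A \<Longrightarrow> degree (u b) \<le> D" "D > 0"
  shows "coeff (coeff (\<Prod>b\<in>A. [:1, u b:]) k) (k * D) = coeff (\<Prod>b\<in>A. [:1, coeff (u b) D:]) k"
  using assms
proof (induction A arbitrary: k rule: finite_induct)
  case (insert a A)
  have "degree (coeff (\<Prod>b\<in>A. [:1, u b:]) j) < Suc j * D" for j
    using degree_coeff_prod_linear[of A u D j] insert by simp
  moreover have "coeff (u a * coeff (\<Prod>b\<in>A. [:1, u b:]) j) (D + j * D)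
      = coeff (u a) D * coeff (\<Prod>b\<in>A. [:1, coeff (u b) D:]) j" for j
    using insert degree_coeff_prod_linear[of A u D j]
    by (simp add: coeff_mult_at_degree_bounds)
  ultimately show ?case
    unfolding prod.insert[OF insert(1,2)] coeff_linear_mult
    using insert by (auto split: nat.split simp: coeff_eq_0)
qed (auto simp: coeff_1)

text \<open>Leibniz rule for the derivative in \<open>X\<close>, with \<open>T\<close> treated as a
  constant: one factor at a time is replaced by its derivative, which is a multiple of
  \<open>T\<close>.\<close>

lemma pderiv_coeff_prod_linear:
  fixes u :: "'i \<Rightarrow> 'a::idom poly"
  assumes "finite A"
  shows "poly (pderiv (coeff (\<Prod>b\<in>A. [:1, u b:]) k)) x =
    coeff (\<Sum>b\<in>A. [:0, poly (pderiv (u b)) x:] * (\<Prod>a\<in>A - {b}. [:1, poly (u a) x:])) k"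
  using assms
proof (induction A arbitrary: k rule: finite_induct)
  case (insert a A)
  let ?v = "\<lambda>b. [:1, poly (u b) x:]" and ?d = "\<lambda>b. [:0, poly (pderiv (u b)) x:]"
  have "?d b * (\<Prod>c\<in>insert a A - {b}. ?v c) = ?v a * (?d b * (\<Prod>c\<in>A - {b}. ?v c))" if "b \<in> A" for b
  proof -
    have "insert a A - {b} = insert a (A - {b})" "a \<notin> A - {b}"
      using insert that by auto
    then show ?thesis using insert by (simp del: mult_pCons_left mult_pCons_right add: ac_simps)
  qed
  then have "(\<Sum>b\<in>A. ?d b * (\<Prod>c\<in>insert a A - {b}. ?v c))
      = ?v a * (\<Sum>b\<in>A. ?d b * (\<Prod>c\<in>A - {b}. ?v c))"
    unfolding sum_distrib_left by (rule sum.cong[OF refl])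
  moreover have "insert a A - {a} = A" using insert by auto
  ultimately have sum_eq: "(\<Sum>b\<in>insert a A. ?d b * (\<Prod>c\<in>insert a A - {b}. ?v c))
      = ?d a * (\<Prod>c\<in>A. ?v c) + ?v a * (\<Sum>b\<in>A. ?d b * (\<Prod>c\<in>A - {b}. ?v c))"
    using insert by (simp only: sum.insert[OF insert(1,2)])
  show ?case
    unfolding sum_eq prod.insert[OF insert(1,2)] coeff_add coeff_linear_mult
    using insert
    by (auto simp: pderiv_add pderiv_mult coeff_pCons poly_coeff_prod_linear split: nat.split)
qed (simp add: coeff_1)

text \<open>Write \<open>p\<close> as \<open>(X - a) ^ m\<close> times \<open>r\<close> with
  \<open>r\<close> nonzero at \<open>a\<close>. In the equation \<open>pderiv p = 0\<close> the
  power \<open>(X - a) ^ (m - 1)\<close> cancels, and evaluating at \<open>a\<close> leaves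
  \<open>of_nat m * poly r a = 0\<close>.\<close>

lemma order_dvd_CHAR:
  fixes p :: "'a::field poly"
  assumes "pderiv p = 0" "p \<noteq> 0"
  shows "CHAR('a) dvd order a p"
proof -
  obtain r where r: "p = [:- a, 1:] ^ order a p * r" "\<not> [:- a, 1:] dvd r"
    using order_decomp[OF assms(2)] by blast
  define m where "m = order a p"
  show ?thesis
  proof (cases m)
    case (Suc j)
    have "0 = pderiv p" using assms by simp
    also have "\<dots> = [:- a, 1:] ^ j * ([:- a, 1:] * pderiv r + smult (of_nat m) r)"
      by (subst r(1), fold m_def, unfold Suc, subst pderiv_mult, subst pderiv_power_Suc)
         (simp add: pderiv_pCons algebra_simps)
    finally have "[:- a, 1:] * pderiv r + smult (of_nat m) r = 0"
      by (simp del: mult_pCons_left)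
    then have "poly ([:- a, 1:] * pderiv r + smult (of_nat m) r) a = 0" by simp
    then have "of_nat m * poly r a = 0" by simp
    moreover have "poly r a \<noteq> 0" using r(2) by (simp add: poly_eq_0_iff_dvd)
    ultimately show ?thesis by (simp add: of_nat_eq_0_iff_char_dvd m_def)
  qed (simp add: m_def)
qed

text \<open>These are the polynomials in the \<open>d\<close>-th power of the variable.\<close>

definition exponents_dvd :: "nat \<Rightarrow> 'a::comm_ring_1 poly \<Rightarrow> bool" where
  "exponents_dvd d p \<longleftrightarrow> (\<forall>k. coeff p k \<noteq> 0 \<longrightarrow> d dvd k)"

lemma exponents_dvd_mult:
  assumes "exponents_dvd d p" "exponents_dvd d r"
  shows "exponents_dvd d (p * r)"
  unfolding exponents_dvd_def
proof (intro allI impI)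
  fix k assume "coeff (p * r) k \<noteq> 0"
  then obtain i where "i \<le> k" "coeff p i * coeff r (k - i) \<noteq> 0"
    unfolding coeff_mult by (metis (mono_tags, lifting) atMost_iff sum.neutral)
  then have "coeff p i \<noteq> 0" "coeff r (k - i) \<noteq> 0" by auto
  then have "d dvd i" "d dvd k - i" using assms unfolding exponents_dvd_def by blast+
  then show "d dvd k" using \<open>i \<le> k\<close> by (metis dvd_diffD1 le_add_diff_inverse dvd_add)
qed

lemma exponents_dvd_prod:
  "(\<And>a. a \<in> A \<Longrightarrow> exponents_dvd d (f a)) \<Longrightarrow> exponents_dvd d (\<Prod>a\<in>A. f a)"
  by (induction A rule: infinite_finite_induct)
     (auto simp: exponents_dvd_mult, auto simp: exponents_dvd_def coeff_1)

lemma exponents_dvd_power: "exponents_dvd d p \<Longrightarrow> exponents_dvd d (p ^ m)"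
  by (induction m) (auto simp: exponents_dvd_mult, auto simp: exponents_dvd_def coeff_1)

lemma coeff_one_minus_monom_mult:
  fixes g :: "'a::comm_ring_1 poly"
  shows "coeff ((1 - monom 1 N) * g) m = coeff g m - (if N \<le> m then coeff g (m - N) else 0)"
  by (simp add: left_diff_distrib coeff_monom_mult)

text \<open>
  The coefficients of \<open>g\<close> at \<open>n\<close>, \<open>n + (q + 1)\<close>, \<dots>, \<open>n + (n - 1) (q + 1)\<close> differ only
  in the first step, and the last of these exponents exceeds the degree of \<open>g\<close>.
\<close>

lemma coeff_relation_by_residues:
  fixes f Q g :: "'a::comm_ring_1 poly" and n q :: nat
  assumes f0: "coeff f 0 = 1" and f_exp: "exponents_dvd n f"
    and rel: "f * Q = (1 - monom 1 (q + 1)) * g"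
    and deg_g: "degree g \<le> (n - 1) * (q + 1) + 1"
    and g0: "\<And>k. k \<le> q \<Longrightarrow> \<not> n dvd k \<Longrightarrow> coeff g k = 0"
    and deg_Q: "degree Q \<le> q + 1"
    and n: "1 < n" "n dvd q"
  shows "coeff g n + coeff f n * coeff Q (q + 1) = 0"
proof -
  have R: "(\<Sum>j\<le>m. coeff f j * coeff Q (m - j))
      = coeff g m - (if q + 1 \<le> m then coeff g (m - (q + 1)) else 0)" for m
    using arg_cong[OF rel, of "\<lambda>p. coeff p m"]
    unfolding coeff_mult[of f Q] coeff_one_minus_monom_mult .
  have f_zero: "coeff f j = 0" if "\<not> n dvd j" for j
    using f_exp that unfolding exponents_dvd_def by auto
  \<comment> \<open>Since \<open>f\<close> has constant term 1, each coefficient of \<open>Q\<close>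
    is that of \<open>g\<close> minus terms with earlier coefficients of \<open>Q\<close>, so the
    vanishing in \<open>g0\<close> carries over to \<open>Q\<close>.\<close>
  have Q_zero: "coeff Q m = 0" if "m \<le> q" "\<not> n dvd m" for m
    using that
  proof (induction m rule: less_induct)
    case (less m)
    have "coeff f j * coeff Q (m - j) = 0" if "j \<in> {..m} - {0}" for j
    proof (cases "n dvd j")
      case True
      then have "\<not> n dvd m - j" using less that by (metis Diff_iff atMost_iff dvd_diffD)
      moreover have "m - j < m" using that less by auto
      ultimately have "coeff Q (m - j) = 0" using less by simp
      then show ?thesis by simp
    qed (simp add: f_zero)
    then have "(\<Sum>j\<le>m. coeff f j * coeff Q (m - j)) = coeff f 0 * coeff Q (m - 0)"
      by (subst sum.remove[of _ 0]) auto
    moreover have "coeff g m = 0" using less g0 by simp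
    ultimately show ?case using R[of m] f0 less by simp
  qed
  \<comment> \<open>Only multiples \<open>j\<close> of \<open>n\<close> contribute, and then the
    complementary index is congruent to \<open>i\<close> modulo \<open>n\<close> because
    \<open>n dvd q\<close>. As \<open>0 < i < n\<close>, a nonzero coefficient of \<open>Q\<close>
    can occur only at the one exponent beyond \<open>q\<close>, namely \<open>q + 1\<close>, which
    forces \<open>i = 1\<close> and \<open>j = n\<close>.\<close>
  have lhs: "(\<Sum>j\<le>n + i * (q + 1). coeff f j * coeff Q (n + i * (q + 1) - j))
      = (if i = 1 then coeff f n * coeff Q (q + 1) else 0)" if i: "1 \<le> i" "i < n" for i
  proof -
    let ?m = "n + i * (q + 1)"
    have m_eq: "?m = (n + (i - 1) * (q + 1)) + (q + 1)" using i by (cases i) auto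
    have dvd_iff: "n dvd n + j * (q + 1) \<longleftrightarrow> n dvd j" for j
      using n by (simp add: dvd_add_left_iff)
    have "coeff f j * coeff Q (?m - j) = 0"
      if j: "j \<le> ?m" "\<not> (i = 1 \<and> j = n)" for j
    proof (cases "n dvd j")
      case True
      have "\<not> n dvd ?m - j"
      proof
        assume "n dvd ?m - j"
        then have "n dvd ?m" using True j by (metis dvd_diffD)
        then have "n dvd i" using dvd_iff by blast
        then show False using i by (auto dest: dvd_imp_le)
      qed
      moreover have "?m - j \<noteq> q + 1"
      proof
        assume "?m - j = q + 1"
        then have j_eq: "j = n + (i - 1) * (q + 1)" using m_eq j by linarith
        then have "n dvd i - 1" using True dvd_iff by blast
        then have "i = 1" using i by (auto dest: dvd_imp_le)
        then show False using j_eq j by simp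
      qed
      ultimately have "coeff Q (?m - j) = 0"
        using Q_zero deg_Q by (cases "?m - j \<le> q") (auto intro: coeff_eq_0)
      then show ?thesis by simp
    qed (simp add: f_zero)
    note zero = this
    show ?thesis
    proof (cases "i = 1")
      case True
      have "(\<Sum>j\<le>?m. coeff f j * coeff Q (?m - j)) = coeff f n * coeff Q (?m - n)"
        using zero True by (subst sum.remove[of _ n]) (auto intro!: sum.neutral simp del: mult_eq_0_iff)
      then show ?thesis using True by simp
    next
      case False
      then show ?thesis using zero by (auto intro!: sum.neutral simp del: mult_eq_0_iff)
    qed
  qed
  have "coeff g (n + i * (q + 1)) = coeff g n + coeff f n * coeff Q (q + 1)"
    if "1 \<le> i" "i < n" for i
    using that
  proof (induction i)
    case (Suc i)
    have m_eq: "n + Suc i * (q + 1) - (q + 1) = n + i * (q + 1)" by simp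
    have "(if Suc i = 1 then coeff f n * coeff Q (q + 1) else 0)
        = coeff g (n + Suc i * (q + 1)) - coeff g (n + i * (q + 1))"
      using R[of "n + Suc i * (q + 1)"] lhs[of "Suc i"] Suc.prems unfolding m_eq by simp
    then show ?case using Suc by (cases "i = 0") (auto simp: algebra_simps)
  qed simp
  from this[of "n - 1"] n have "coeff g (n + (n - 1) * (q + 1)) = coeff g n + coeff f n * coeff Q (q + 1)"
    by linarith
  moreover have "coeff g (n + (n - 1) * (q + 1)) = 0"
    using deg_g n by (intro coeff_eq_0) linarith
  ultimately show ?thesis by simp
qed

section \<open>Affine maximal arcs in odd characteristic\<close>

lemma geometric_sum_from_one:
  fixes y :: "'a::comm_ring_1"
  shows "(1 - y) * (\<Sum>i=1..N. y ^ i) = y - y ^ Suc N"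
proof (induction N)
  case (Suc N)
  have "(1 - y) * (\<Sum>i=1..Suc N. y ^ i) = (1 - y) * (\<Sum>i=1..N. y ^ i) + (1 - y) * y ^ Suc N"
    by (simp add: distrib_left)
  also have "\<dots> = y - y ^ Suc (Suc N)"
    unfolding Suc by (simp add: left_diff_distrib)
  finally show ?case .
qed simp

lemma coeff_one_plus_monom_power:
  fixes a :: "'a::comm_ring_1"
  assumes "0 < d"
  shows "coeff ((1 + monom a d) ^ m) d = of_nat m * a"
proof -
  have c0: "coeff ((1 + monom a d) ^ j) 0 = 1" for j
    using assms by (simp add: coeff_0_power coeff_1)
  show ?thesis
    using assms c0
    by (induction m) (auto simp: distrib_right coeff_monom_mult coeff_1 algebra_simps)
qed

text \<open>\<open>E\<close> is the copy of \<open>GF(q^2)\<close> inside a larger field, and the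
  solutions of \<open>t ^ q = t\<close> form its subfield \<open>GF(q)\<close>. Over this subfield
  \<open>E\<close> is an affine plane, whose lines are the sets of points
  \<open>x + t * z\<close>.\<close>

locale affine_maximal_arc =
  fixes B E :: "'b::field set" and q n e h :: nat
  assumes prime_char: "prime CHAR('b)" and char_gt_2: "CHAR('b) > 2"
    and n_eq: "n = CHAR('b) ^ e" and q_eq: "q = CHAR('b) ^ h"
    and n_gt_1: "1 < n" and n_less_q: "n < q"
    and card_E: "card E = q ^ 2" and E_power: "z \<in> E \<Longrightarrow> z ^ (q ^ 2) = z"
    and E_diff: "x \<in> E \<Longrightarrow> y \<in> E \<Longrightarrow> x - y \<in> E"
    and B_subset: "B \<subseteq> E" and card_B: "card B = (n - 1) * (q + 1) + 1"
    and arc: "x \<in> E \<Longrightarrow> z \<in> E \<Longrightarrow> z \<noteq> 0 \<Longrightarrow> card {b \<in> B. \<exists>t. t ^ q = t \<and> b = x + t * z} \<in> {0, n}"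
begin

lemma finite_E: "finite E"
  using card_E n_less_q by (intro card_ge_0_finite) simp

lemma finite_B: "finite B"
  using finite_E B_subset by (rule rev_finite_subset)

lemma e_less_h: "e < h"
  using n_less_q prime_char unfolding n_eq q_eq
  by (metis linorder_not_less power_increasing prime_ge_1_nat)

lemma n_dvd_q: "n dvd q"
  unfolding n_eq q_eq using e_less_h by (simp add: le_imp_power_dvd)

lemma three_n_le_q: "3 * n \<le> q"
proof -
  have "3 * n \<le> CHAR('b) * n" using char_gt_2 by simp
  also have "\<dots> = CHAR('b) ^ Suc e" by (simp add: n_eq)
  also have "\<dots> \<le> q" unfolding q_eq using e_less_h prime_ge_1_nat[OF prime_char]
    by (intro power_increasing) auto
  finally show ?thesis .
qed

lemma of_nat_q: "of_nat q = (0 :: 'b)"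
  unfolding q_eq using e_less_h by simp

lemma E_unit_power:
  assumes "z \<in> E" "z \<noteq> 0"
  shows "(z ^ (q - 1)) ^ (q + 1) = 1"
proof -
  have "q ^ 2 = Suc ((q - 1) * (q + 1))"
    using n_less_q by (cases q) (auto simp: power2_eq_square)
  then have "z * (z ^ (q - 1)) ^ (q + 1) = z"
    using E_power[OF assms(1)] by (simp only: power_Suc power_mult)
  then show ?thesis using assms(2) by simp
qed

text \<open>For \<open>b \<noteq> x\<close> this value names the line joining \<open>x\<close> and
  \<open>b\<close>: the power \<open>q - 1\<close> removes exactly the nonzero scalars from
  \<open>GF(q)\<close>. At \<open>b = x\<close> it is 0.\<close>

definition dir :: "'b \<Rightarrow> 'b \<Rightarrow> 'b" where
  "dir x b = (x - b) ^ (q - 1)"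

lemma dir_power: "x \<in> E \<Longrightarrow> b \<in> E \<Longrightarrow> b \<noteq> x \<Longrightarrow> dir x b ^ (q + 1) = 1"
  unfolding dir_def using E_unit_power E_diff by simp

lemma dir_fibre:
  assumes "b0 \<noteq> x"
  shows "{b \<in> B - {x}. dir x b = dir x b0} = {b \<in> B. \<exists>t. t ^ q = t \<and> b = x + t * (b0 - x)} - {x}"
proof (intro Set.set_eqI iffI)
  have q: "q = Suc (q - 1)" using n_less_q by simp
  fix b
  {
    assume b: "b \<in> {b \<in> B - {x}. dir x b = dir x b0}"
    define t where "t = (x - b) / (x - b0)"
    have "t ^ (q - 1) = 1" using b assms by (simp add: t_def power_divide dir_def)
    then have "t ^ q = t" using q power_Suc[of t "q - 1"] by (metis mult.right_neutral)
    moreover have "t * (x - b0) = x - b" using assms by (simp add: t_def)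
    then have "b = x - t * (x - b0)" by simp
    then have "b = x + t * (b0 - x)" by (simp only: right_diff_distrib diff_diff_eq2 add_diff_eq)
    ultimately show "b \<in> {b \<in> B. \<exists>t. t ^ q = t \<and> b = x + t * (b0 - x)} - {x}" using b by auto
  next
    assume b: "b \<in> {b \<in> B. \<exists>t. t ^ q = t \<and> b = x + t * (b0 - x)} - {x}"
    then obtain t where t: "t ^ q = t" "b = x + t * (b0 - x)" by auto
    then have "t \<noteq> 0" using b by auto
    moreover have "t * t ^ (q - 1) = t" using t(1) q power_Suc[of t "q - 1"] by metis
    ultimately have "t ^ (q - 1) = 1" by simp
    moreover have "x - b = t * (x - b0)" unfolding t(2) by (simp add: algebra_simps)
    ultimately have "dir x b = dir x b0" by (simp add: dir_def power_mult_distrib)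
    then show "b \<in> {b \<in> B - {x}. dir x b = dir x b0}" using b by auto
  }
qed

text \<open>The line through \<open>x\<close> and \<open>b0\<close> contains a point of
  \<open>B\<close>, hence \<open>n\<close> of them; \<open>x\<close> itself is discounted if it is
  one.\<close>

lemma card_dir_fibre:
  assumes "x \<in> E" "b0 \<in> B - {x}"
  shows "card {b \<in> B - {x}. dir x b = dir x b0} = (if x \<in> B then n - 1 else n)"
proof -
  let ?L = "{b \<in> B. \<exists>t. t ^ q = t \<and> b = x + t * (b0 - x)}"
  have "b0 - x \<in> E" "b0 - x \<noteq> 0" using assms B_subset E_diff by auto
  then have "card ?L \<in> {0, n}" using arc[of x "b0 - x"] assms by simp
  moreover have "b0 \<in> ?L" using assms by (auto intro: exI[of _ 1])
  moreover have fin: "finite ?L" using finite_B by simp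
  ultimately have "card ?L = n" by (metis (no_types, lifting) card_0_eq empty_iff insert_iff)
  moreover have "x \<in> ?L \<longleftrightarrow> x \<in> B" using n_less_q by (auto intro: exI[of _ 0])
  ultimately show ?thesis
    using dir_fibre[of b0 x] assms fin by (auto simp: card_Diff_singleton_if)
qed

definition dir_poly :: "'b \<Rightarrow> 'b poly" where
  "dir_poly x = (\<Prod>b\<in>B. [:1, - dir x b:])"

text \<open>The factors are grouped by lines through \<open>x\<close>, all of which carry equally
  many points of \<open>B\<close> other than \<open>x\<close>. A factor for \<open>b = x\<close>
  equals 1 because \<open>dir x x = 0\<close>.\<close>

lemma dir_poly_eq_power:
  assumes "x \<in> E"
  shows "dir_poly x = (\<Prod>w\<in>dir x ` (B - {x}). [:1, - w:]) ^ (if x \<in> B then n - 1 else n)"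
proof -
  have "dir_poly x = (\<Prod>b\<in>B - {x}. [:1, - dir x b:])"
    unfolding dir_poly_def using finite_B n_gt_1 n_less_q
    by (intro prod.mono_neutral_right) (auto simp: dir_def power_0_left one_pCons)
  also have "\<dots> = (\<Prod>w\<in>dir x ` (B - {x}). \<Prod>b\<in>{b \<in> B - {x}. dir x b = w}. [:1, - dir x b:])"
    using finite_B by (intro prod.image_gen) auto
  also have "\<dots> = (\<Prod>w\<in>dir x ` (B - {x}). [:1, - w:] ^ (if x \<in> B then n - 1 else n))"
  proof (intro prod.cong refl)
    fix w assume "w \<in> dir x ` (B - {x})"
    then obtain b0 where b0: "b0 \<in> B - {x}" "w = dir x b0" by auto
    have "(\<Prod>b\<in>{b \<in> B - {x}. dir x b = w}. [:1, - dir x b:])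
        = (\<Prod>b\<in>{b \<in> B - {x}. dir x b = w}. [:1, - w:])"
      by (intro prod.cong) auto
    then show "(\<Prod>b\<in>{b \<in> B - {x}. dir x b = w}. [:1, - dir x b:])
        = [:1, - w:] ^ (if x \<in> B then n - 1 else n)"
      using card_dir_fibre[OF assms b0(1)] b0(2) by simp
  qed
  finally show ?thesis by (simp add: prod_power_distrib)
qed

lemma linear_power_n: "[:1, a:] ^ n = 1 + monom (a ^ n) n" for a :: 'b
proof -
  have "[:1, a:] ^ n = (1 + monom a 1) ^ n" by (simp add: monom_Suc one_pCons monom_0)
  also have "\<dots> = 1 ^ n + monom a 1 ^ n"
    using prime_char n_eq by (intro freshmans_dream'[where n = e]) auto
  finally show ?thesis by (simp add: monom_power)
qed

text \<open>Outside \<open>B\<close> the product is an \<open>n\<close>-th power, and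
  \<open>n\<close> is a power of the characteristic.\<close>

lemma exponents_dir_poly_outside:
  assumes "x \<in> E" "x \<notin> B"
  shows "exponents_dvd n (dir_poly x)"
proof -
  have "dir_poly x = (\<Prod>w\<in>dir x ` (B - {x}). [:1, - w:] ^ n)"
    using dir_poly_eq_power[OF assms(1)] assms(2) by (simp add: prod_power_distrib)
  moreover have "exponents_dvd n ([:1, - w:] ^ n)" for w :: 'b
    unfolding linear_power_n by (auto simp: exponents_dvd_def coeff_1 split: if_splits)
  ultimately show ?thesis by (simp add: exponents_dvd_prod)
qed

text \<open>Counting \<open>B\<close> along the lines through \<open>x\<close> shows that all
  \<open>q + 1\<close> directions occur. They are the roots of unity of order dividing
  \<open>q + 1\<close>, so the product is \<open>(1 - T ^ (q + 1)) ^ (n - 1)\<close>.\<close>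

lemma exponents_dir_poly_inside:
  assumes x: "x \<in> B"
  shows "exponents_dvd (q + 1) (dir_poly x)"
proof -
  define W where "W = dir x ` (B - {x})"
  have xE: "x \<in> E" using x B_subset by auto
  have finW: "finite W" using finite_B by (simp add: W_def)
  have W1: "w ^ (q + 1) = 1" if "w \<in> W" for w
    using that dir_power[OF xE] B_subset unfolding W_def by blast
  have "card (B - {x}) = (\<Sum>w\<in>W. card {b \<in> B - {x}. dir x b = w})"
    unfolding W_def using finite_B sum.image_gen[of "B - {x}" "\<lambda>_. 1::nat" "dir x"] by simp
  also have "\<dots> = (\<Sum>w\<in>W. n - 1)"
    using card_dir_fibre[OF xE] x unfolding W_def by (intro sum.cong) auto
  finally have "card W * (n - 1) = (q + 1) * (n - 1)"
    using card_B x finite_B by (simp add: algebra_simps)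
  then have cardW: "card W = q + 1" using n_gt_1 unfolding mult_cancel2 by linarith
  let ?P = "\<Prod>w\<in>W. [:1, - w:]" and ?R = "1 - monom 1 (q + 1) :: 'b poly"
  \<comment> \<open>Both sides have degree at most \<open>q + 1\<close> and agree at
    \<open>q + 2\<close> places: at 0 and at the inverses of the directions.\<close>
  have "?P = ?R"
  proof (rule poly_eqI_degree[where A = "insert 0 (inverse ` W)"])
    have W0: "w \<noteq> 0" if "w \<in> W" for w using W1[OF that] by (auto simp: power_0_left)
    then have "0 \<notin> inverse ` W" by auto
    then have card_A: "card (insert 0 (inverse ` W)) = q + 2"
      using finW cardW by (simp add: card_image inj_on_def)
    have "degree ?P \<le> (\<Sum>w\<in>W. degree [:1, - w:])"
      using degree_prod_sum_le[OF finW, of "\<lambda>w. [:1, - w:]"] by (simp add: o_def)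
    also have "\<dots> \<le> (\<Sum>w\<in>W. 1)" by (intro sum_mono) auto
    finally show "degree ?P < card (insert 0 (inverse ` W))" using card_A cardW by simp
    have "degree ?R \<le> q + 1" by (intro degree_diff_le) (auto simp: degree_monom_le)
    then show "degree ?R < card (insert 0 (inverse ` W))" using card_A by simp
    show "poly ?P y = poly ?R y" if y: "y \<in> insert 0 (inverse ` W)" for y
    proof (cases "y = 0")
      case False
      then obtain w where w: "w \<in> W" "y = inverse w" using y by auto
      have "poly ?P y = 0" using w W0 finW by (auto simp: poly_prod intro!: bexI[of _ w])
      moreover have "poly ?R y = 0" using w W1[of w] by (simp add: poly_monom power_inverse del: power_Suc)
      ultimately show ?thesis by simp
    qed (simp add: poly_prod poly_monom)
  qed
  moreover have "exponents_dvd (q + 1) ?R"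
    by (auto simp: exponents_dvd_def coeff_1 split: if_splits)
  ultimately show ?thesis
    using dir_poly_eq_power[OF xE] x by (simp add: W_def exponents_dvd_power)
qed


section \<open>Coefficients of the direction polynomial as polynomials in the point\<close>

definition arc_coeff :: "nat \<Rightarrow> 'b poly" where
  "arc_coeff k = coeff (\<Prod>b\<in>B. [:1, - ([:- b, 1:] ^ (q - 1)):]) k"

lemma poly_arc_coeff: "poly (arc_coeff k) x = coeff (dir_poly x) k"
  unfolding arc_coeff_def poly_coeff_prod_linear[OF finite_B] dir_poly_def dir_def by simp

lemma degree_linear_power: "degree (- ([:- b, 1:] ^ (q - 1))) \<le> q - 1" for b :: 'b
  using degree_power_le[of "[:- b, 1:]" "q - 1"] by simp

lemma degree_arc_coeff: "degree (arc_coeff k) \<le> k * (q - 1)"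
  unfolding arc_coeff_def
  by (rule degree_coeff_prod_linear[OF finite_B]) (rule degree_linear_power)

lemma arc_coeff_inside:
  assumes "x \<in> B" "0 < k" "k \<le> q"
  shows "poly (arc_coeff k) x = 0"
proof -
  have "\<not> q + 1 dvd k" using assms(2,3) by (auto dest: dvd_imp_le)
  then show ?thesis
    using exponents_dir_poly_inside[OF assms(1)] unfolding poly_arc_coeff exponents_dvd_def by blast
qed

text \<open>Inside \<open>B\<close> only exponents divisible by \<open>q + 1\<close> occur, outside
  only those divisible by \<open>n\<close>. Hence this coefficient vanishes on all of
  \<open>E\<close>, while its degree is below \<open>q ^ 2\<close>.\<close>

lemma arc_coeff_eq_0:
  assumes "k \<le> q" "\<not> n dvd k"
  shows "arc_coeff k = 0"
proof (rule poly_eqI_degree[where A = E])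
  fix x assume "x \<in> E"
  then show "poly (arc_coeff k) x = poly 0 x"
    using arc_coeff_inside[of x k] exponents_dir_poly_outside[of x] assms
    by (cases "x \<in> B"; cases "k = 0") (auto simp: poly_arc_coeff exponents_dvd_def)
next
  have "degree (arc_coeff k) \<le> q * (q - 1)"
    using degree_arc_coeff[of k] assms(1) by (meson le_trans mult_le_mono1)
  also have "\<dots> < q ^ 2" using n_less_q by (simp add: power2_eq_square)
  finally show "degree (arc_coeff k) < card E" by (simp add: card_E)
  show "degree (0 :: 'b poly) < card E" using n_less_q by (simp add: card_E)
qed

text \<open>Its coefficient at \<open>n * (q - 1)\<close> is that of \<open>T ^ n\<close> in
  \<open>(1 - T) ^ card B\<close>. Here \<open>card B = n * m\<close> with
  \<open>m = q + 1 - q / n\<close>, so the power is \<open>(1 + (-1) ^ n * T ^ n) ^ m\<close>, and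
  \<open>m\<close> is 1 modulo the characteristic.\<close>

lemma arc_coeff_n_nonzero: "arc_coeff n \<noteq> 0"
proof -
  obtain r where r: "q = n * r" using n_dvd_q by blast
  have n_pos: "0 < n" using n_gt_1 by simp
  have "CHAR('b) ^ h = CHAR('b) ^ e * CHAR('b) ^ (h - e)"
    using e_less_h by (simp flip: power_add)
  then have "n * r = n * CHAR('b) ^ (h - e)" using r q_eq n_eq by metis
  then have "r = CHAR('b) ^ (h - e)" using n_pos by simp
  then have r0: "of_nat r = (0 :: 'b)" using e_less_h by simp
  have "r \<le> q" using r n_pos by simp
  define m where "m = q + 1 - r"
  have m: "m + r = q + 1" using \<open>r \<le> q\<close> by (simp add: m_def)
  have "of_nat (m + r) = (1 :: 'b)" unfolding m using of_nat_q by simp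
  then have m1: "of_nat m = (1 :: 'b)" using r0 by simp
  have "card B + q = n * (q + 1)" using card_B n_pos by (cases n) auto
  also have "\<dots> = n * m + q" unfolding m[symmetric] distrib_left using r by simp
  finally have cB: "card B = n * m" by simp
  have lead: "coeff (- ([:- b, 1:] ^ (q - 1))) (q - 1) = -1" for b :: 'b
    using lead_coeff_power[of "[:- b, 1:]" "q - 1"] by (simp add: degree_power_eq)
  have "coeff (arc_coeff n) (n * (q - 1)) = coeff (\<Prod>b\<in>B. [:1, -1:]) n"
    unfolding arc_coeff_def
    using n_gt_1 n_less_q
    by (subst lead_coeff_prod_linear[OF finite_B degree_linear_power]) (simp, simp only: lead)
  also have "\<dots> = coeff ((1 + monom ((-1) ^ n) n) ^ m) n"
    by (simp add: cB power_mult linear_power_n)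
  also have "\<dots> \<noteq> 0" using n_pos by (simp add: coeff_one_plus_monom_power m1)
  finally show ?thesis by auto
qed

text \<open>The derivative in \<open>X\<close>, taken at \<open>x\<close>, of the product over
  \<open>1 - (X - b) ^ (q - 1) * T\<close>. The factor \<open>-(q - 1)\<close> from the power rule
  is 1 because \<open>q\<close> vanishes in the field.\<close>

definition arc_deriv :: "'b \<Rightarrow> 'b poly" where
  "arc_deriv x = (\<Sum>b\<in>B. [:0, (x - b) ^ (q - 2):] * (\<Prod>a\<in>B - {b}. [:1, - dir x a:]))"

lemma poly_pderiv_arc_coeff: "poly (pderiv (arc_coeff k)) x = coeff (arc_deriv x) k"
proof -
  have "of_nat (q - 1) = (-1 :: 'b)"
    using n_less_q of_nat_q by (simp add: of_nat_diff)
  then have "poly (pderiv (- ([:- b, 1:] ^ (q - 1)))) x = (x - b) ^ (q - 2)" for b :: 'b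
    by (simp add: pderiv_minus pderiv_power pderiv_pCons numeral_2_eq_2)
  then show ?thesis
    unfolding arc_coeff_def arc_deriv_def pderiv_coeff_prod_linear[OF finite_B] by (simp add: dir_def)
qed

text \<open>With \<open>w = dir x b\<close>, the logarithmic derivative of the product is the sum of
  \<open>w * T / (1 - w * T)\<close> divided by \<open>x - b\<close>. Since
  \<open>w ^ (q + 1) = 1\<close>, multiplying by \<open>1 - T ^ (q + 1)\<close> turns each geometric
  series into its first \<open>q + 1\<close> terms. This gives the polynomial \<open>Q\<close>, to
  which \<open>coeff_relation_by_residues\<close> applies.\<close>

lemma arc_deriv_relation:
  assumes x: "x \<in> E" "x \<notin> B"
  shows "coeff (arc_deriv x) n + coeff (dir_poly x) n * (\<Sum>b\<in>B. 1 / (x - b)) = 0"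
proof -
  let ?g = "\<lambda>b. \<Sum>i=1..q+1. monom (dir x b) 1 ^ i"
  define Q where "Q = (\<Sum>b\<in>B. smult (1 / (x - b)) (?g b))"
  have dir1: "dir x b ^ (q + 1) = 1" if "b \<in> B" for b
    using dir_power[of x b] that x B_subset by auto
  have coeff_Q: "coeff Q k = (if 1 \<le> k \<and> k \<le> q + 1 then \<Sum>b\<in>B. dir x b ^ k / (x - b) else 0)" for k
  proof -
    have "coeff (?g b) k = (if 1 \<le> k \<and> k \<le> q + 1 then dir x b ^ k else 0)" for b
      by (simp add: coeff_sum monom_power if_distrib cong: if_cong del: sum.cl_ivl_Suc)
    then show ?thesis by (auto simp: Q_def coeff_sum intro!: sum.cong sum.neutral)
  qed
  have "coeff (arc_deriv x) n + coeff (dir_poly x) n * coeff Q (q + 1) = 0"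
  proof (rule coeff_relation_by_residues)
    show "coeff (dir_poly x) 0 = 1" by (simp add: dir_poly_def poly_prod flip: poly_0_coeff_0)
    show "exponents_dvd n (dir_poly x)" using exponents_dir_poly_outside x by simp
    show "degree (arc_deriv x) \<le> (n - 1) * (q + 1) + 1"
    proof -
      have "degree ([:0, (x - b) ^ (q - 2):] * (\<Prod>a\<in>B - {b}. [:1, - dir x a:])) \<le> card B"
        if b: "b \<in> B" for b
      proof -
        have "degree (\<Prod>a\<in>B - {b}. [:1, - dir x a:]) \<le> (\<Sum>a\<in>B - {b}. degree [:1, - dir x a:])"
          using degree_prod_sum_le[of "B - {b}" "\<lambda>a. [:1, - dir x a:]"] finite_B by (simp add: o_def)
        also have "\<dots> \<le> (\<Sum>a\<in>B - {b}. 1)" by (intro sum_mono) auto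
        also have "\<dots> = card B - 1" using finite_B b by simp
        finally have "degree (\<Prod>a\<in>B - {b}. [:1, - dir x a:]) \<le> card B - 1" .
        moreover have "degree [:0, (x - b) ^ (q - 2):] \<le> 1" by simp
        moreover have "1 \<le> card B" using card_B by simp
        ultimately show ?thesis
          using degree_mult_le[of "[:0, (x - b) ^ (q - 2):]" "\<Prod>a\<in>B - {b}. [:1, - dir x a:]"]
          by linarith
      qed
      then show ?thesis unfolding arc_deriv_def card_B[symmetric]
        using finite_B by (intro degree_sum_le) auto
    qed
    show "coeff (arc_deriv x) k = 0" if "k \<le> q" "\<not> n dvd k" for k
      using arc_coeff_eq_0[OF that] poly_pderiv_arc_coeff[of k x] by simp
    show "degree Q \<le> q + 1" by (rule degree_le) (simp add: coeff_Q)
    show "1 < n" "n dvd q" using n_gt_1 n_dvd_q by auto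
    show "dir_poly x * Q = (1 - monom 1 (q + 1)) * arc_deriv x"
    proof -
      have "dir_poly x * smult (1 / (x - b)) (?g b)
          = (1 - monom 1 (q + 1)) * ([:0, (x - b) ^ (q - 2):] * (\<Prod>a\<in>B - {b}. [:1, - dir x a:]))"
        if b: "b \<in> B" for b
      proof -
        let ?w = "dir x b" and ?P = "\<Prod>a\<in>B - {b}. [:1, - dir x a:]"
        have "[:1, - ?w:] * ?g b = (1 - monom ?w 1) * ?g b"
          by (simp add: monom_Suc monom_0 one_pCons)
        also have "\<dots> = monom ?w 1 - monom ?w 1 ^ Suc (q + 1)"
          by (rule geometric_sum_from_one)
        also have "monom ?w 1 ^ Suc (q + 1) = monom ?w 1 * monom 1 (q + 1)"
          using dir1[OF b] power_Suc[of ?w "q + 1"] by (simp add: monom_power mult_monom del: power_Suc)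
        finally have 1: "[:1, - ?w:] * ?g b = (1 - monom 1 (q + 1)) * monom ?w 1"
          by (simp add: algebra_simps)
        have "Suc (q - 2) = q - 1" using n_gt_1 n_less_q by linarith
        then have "(x - b) ^ (q - 1) = (x - b) * (x - b) ^ (q - 2)"
          by (metis power_Suc)
        then have 2: "smult (1 / (x - b)) (monom ?w 1) = [:0, (x - b) ^ (q - 2):]"
          using x b by (auto simp: dir_def monom_Suc monom_0)
        have "dir_poly x = [:1, - ?w:] * ?P"
          unfolding dir_poly_def using finite_B b by (rule prod.remove)
        then have "dir_poly x * smult (1 / (x - b)) (?g b) = smult (1 / (x - b)) ([:1, - ?w:] * ?g b) * ?P"
          by (simp only: mult_smult_right mult_smult_left) (simp only: ac_simps)
        also have "\<dots> = (1 - monom 1 (q + 1)) * (smult (1 / (x - b)) (monom ?w 1) * ?P)"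
          unfolding 1 by (simp only: mult_smult_right mult_smult_left mult.assoc)
        finally show ?thesis unfolding 2 .
      qed
      then show ?thesis unfolding Q_def arc_deriv_def sum_distrib_left by (intro sum.cong refl)
    qed
  qed
  moreover have "coeff Q (q + 1) = (\<Sum>b\<in>B. 1 / (x - b))"
    unfolding coeff_Q using dir1 by simp
  ultimately show ?thesis by simp
qed

text \<open>
  Here \<open>(\<Prod>b\<in>B. X - b) * arc_coeff n\<close> is a polynomial of degree less than three times the number
  of its roots in \<open>B\<close>, although its vanishing derivative makes all root orders divisible by the
  characteristic.
\<close>

theorem no_affine_maximal_arc: False
proof -
  define R where "R = (\<Prod>b\<in>B. [:- b, 1:])"
  define S where "S = R * arc_coeff n"
  have R_root: "poly R x = 0 \<longleftrightarrow> x \<in> B" for x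
    unfolding R_def using finite_B by (auto simp: poly_prod)
  have R0: "R \<noteq> 0" unfolding R_def using finite_B by auto
  then have S0: "S \<noteq> 0" unfolding S_def using arc_coeff_n_nonzero by simp
  have "degree R = card B" unfolding R_def by (subst degree_prod_eq_sum_degree) auto
  then have deg_S: "degree S \<le> card B + n * (q - 1)"
    unfolding S_def using degree_mult_le[of R "arc_coeff n"] degree_arc_coeff[of n] by linarith
  have sizes: "card B + n * (q - 1) + q = 2 * (n * q)"
    using card_B n_gt_1 n_less_q by (cases n; cases q) auto
  have "pderiv S = 0"
  proof (rule poly_eqI_degree[where A = E])
    fix x assume x: "x \<in> E"
    have dS: "poly (pderiv S) x = poly R x * poly (pderiv (arc_coeff n)) x + poly (arc_coeff n) x * poly (pderiv R) x"
      unfolding S_def by (simp add: pderiv_mult)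
    show "poly (pderiv S) x = poly 0 x"
    proof (cases "x \<in> B")
      case True
      then show ?thesis using dS R_root arc_coeff_inside[of x n] n_gt_1 n_less_q by simp
    next
      case False
      have "poly (pderiv R) x = (\<Sum>b\<in>B. poly R x * (1 / (x - b)))"
        unfolding R_def pderiv_prod poly_sum
      proof (intro sum.cong refl)
        fix b assume b: "b \<in> B"
        have "poly (\<Prod>b\<in>B. [:- b, 1:]) x = (x - b) * poly (\<Prod>b\<in>B - {b}. [:- b, 1:]) x"
          by (subst prod.remove[OF finite_B b]) (simp add: algebra_simps)
        then show "poly ((\<Prod>b\<in>B - {b}. [:- b, 1:]) * pderiv [:- b, 1:]) x
            = poly (\<Prod>b\<in>B. [:- b, 1:]) x * (1 / (x - b))"
          using False b by (auto simp: pderiv_pCons)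
      qed
      then have "poly (pderiv R) x = poly R x * (\<Sum>b\<in>B. 1 / (x - b))"
        by (simp add: sum_distrib_left)
      then have "poly (pderiv S) x
          = poly R x * (coeff (arc_deriv x) n + coeff (dir_poly x) n * (\<Sum>b\<in>B. 1 / (x - b)))"
        unfolding dS poly_pderiv_arc_coeff poly_arc_coeff by (simp add: algebra_simps)
      then show ?thesis using arc_deriv_relation[OF x False] by simp
    qed
  next
    have "2 * (n * q) \<le> q * q" using three_n_le_q by (simp flip: mult.assoc)
    then have "degree S < q ^ 2" unfolding power2_eq_square using deg_S sizes n_less_q by linarith
    moreover have "degree (pderiv S) \<le> degree S"
      by (intro degree_le) (auto simp: coeff_pderiv coeff_eq_0)
    ultimately show "degree (pderiv S) < card E" unfolding card_E by simp
    show "degree (0 :: 'b poly) < card E" using n_less_q by (simp add: card_E)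
  qed
  have "3 \<le> order b S" if "b \<in> B" for b
  proof -
    have "poly S b = 0" using that R_root by (simp add: S_def)
    then have "order b S \<noteq> 0" using S0 by (simp add: order_root)
    moreover have "CHAR('b) dvd order b S" using \<open>pderiv S = 0\<close> S0 by (rule order_dvd_CHAR)
    ultimately have "CHAR('b) \<le> order b S" by (auto dest: dvd_imp_le)
    then show ?thesis using char_gt_2 by simp
  qed
  then have "3 * card B \<le> (\<Sum>b\<in>B. order b S)"
    using sum_mono[of B "\<lambda>_. 3" "\<lambda>b. order b S"] by (simp add: mult.commute)
  also have "\<dots> \<le> (\<Sum>x | poly S x = 0. order x S)"
    using R_root S0 by (intro sum_mono2) (auto simp: S_def poly_roots_finite finite_B)
  also have "\<dots> \<le> degree S" by (rule sum_order_le_degree[OF S0])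
  \<comment> \<open>As \<open>card B = n * q + n - q\<close>, this reads
    \<open>n * q + 3 * n \<le> 2 * q\<close>, against \<open>1 < n\<close>.\<close>
  finally have "2 * card B \<le> n * (q - 1)" using deg_S by simp
  moreover have "n * (q - 1) \<le> n * q" by simp
  moreover have "2 * q \<le> n * q" using n_gt_1 by simp
  moreover have "card B + q = n * q + n" using card_B n_gt_1 by (cases n) auto
  ultimately show False using n_gt_1 by linarith
qed

end

section \<open>Finite fields: prime power order and Frobenius\<close>

lemma power_of_only_prime_divisor:
  fixes m p :: nat
  assumes "0 < m" "\<And>r. prime r \<Longrightarrow> r dvd m \<Longrightarrow> r = p"
  shows "\<exists>h. m = p ^ h"
  using assms
proof (induction m rule: less_induct)
  case (less m)
  show ?case
  proof (cases "m = 1")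
    case True
    then show ?thesis by (intro exI[of _ 0]) simp
  next
    case False
    then obtain r where r: "prime r" "r dvd m" using prime_factor_nat by blast
    then have rp: "r = p" by (rule less.prems(2))
    then obtain m' where m': "m = p * m'" using r(2) by (auto elim: dvdE)
    have "p > 1" using r(1) rp prime_gt_1_nat by simp
    then have "m' < m" "0 < m'" using m' less.prems(1) by auto
    moreover have "\<And>r. prime r \<Longrightarrow> r dvd m' \<Longrightarrow> r = p" using less.prems(2) m' by simp
    ultimately obtain h where "m' = p ^ h" using less.IH by blast
    then show ?thesis using m' by (intro exI[of _ "Suc h"]) simp
  qed
qed

lemma prime_CHAR_finite_field: "prime CHAR('a::{field,finite})"
  by (rule prime_CHAR_semidom) (rule finite_imp_CHAR_pos, simp)

text \<open>For a prime \<open>r\<close> dividing the order, Sylow's theorem gives an additive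
  subgroup of order \<open>r\<close>. A nonzero element of it is annihilated by \<open>r\<close>, so
  the characteristic divides \<open>r\<close>.\<close>

lemma finite_field_card_eq_CHAR_power: "\<exists>h. CARD('a::{field,finite}) = CHAR('a) ^ h"
proof (rule power_of_only_prime_divisor)
  fix r assume r: "prime r" "r dvd CARD('a)"
  define G where "G = \<lparr>carrier = (UNIV :: 'a set), monoid.mult = (+), one = (0 :: 'a)\<rparr>"
  interpret group G
  proof (rule groupI)
    fix x assume x: "x \<in> carrier G"
    show "\<exists>y\<in>carrier G. y \<otimes>\<^bsub>G\<^esub> x = \<one>\<^bsub>G\<^esub>"
      by (intro bexI[of _ "- x"]) (auto simp: G_def)
  qed (auto simp: G_def add_ac)
  obtain m where "Coset.order G = r ^ 1 * m"
    using r(2) by (auto simp: Coset.order_def G_def elim: dvdE)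
  moreover have "finite (carrier G)" by (simp add: G_def)
  ultimately obtain H where H: "subgroup H G" "card H = r ^ 1"
    using sylow_thm[OF r(1) is_group] by blast
  have fin: "finite H" by (rule finite_subset[of _ UNIV]) simp_all
  have "0 \<in> H" using subgroup.one_closed[OF H(1)] by (simp add: G_def)
  have "1 < card H" using H r prime_gt_1_nat by simp
  then have "H \<noteq> {0}" by auto
  then obtain x where x: "x \<in> H" "x \<noteq> 0" using \<open>0 \<in> H\<close> by blast
  interpret GH: group "G\<lparr>carrier := H\<rparr>" using H(1) by (rule subgroup_imp_group)
  have mult: "y \<otimes>\<^bsub>G\<lparr>carrier := H\<rparr>\<^esub> z = y + z" for y z by (simp add: G_def)
  have one: "\<one>\<^bsub>G\<lparr>carrier := H\<rparr>\<^esub> = 0" by (simp add: G_def)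
  have pow: "x [^]\<^bsub>G\<lparr>carrier := H\<rparr>\<^esub> k = of_nat k * x" for k :: nat
  proof (induction k)
    case 0
    show ?case by (simp only: GH.nat_pow_0 one of_nat_0 mult_zero_left)
  next
    case (Suc k)
    show ?case by (simp only: GH.nat_pow_Suc mult Suc of_nat_Suc distrib_right mult_1 add.commute)
  qed
  have "x [^]\<^bsub>G\<lparr>carrier := H\<rparr>\<^esub> Coset.order (G\<lparr>carrier := H\<rparr>) = \<one>\<^bsub>G\<lparr>carrier := H\<rparr>\<^esub>"
    using x by (intro GH.pow_order_eq_1) simp
  then have "of_nat r * x = 0" using H(2) unfolding pow one by (simp add: Coset.order_def)
  then have "CHAR('a) dvd r" using x by (simp add: of_nat_eq_0_iff_char_dvd)
  then show "r = CHAR('a)"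
    using r(1) prime_CHAR_finite_field[where 'a = 'a] primes_dvd_imp_eq by metis
qed simp

lemma finite_field_power_card: "x ^ CARD('a) = (x :: 'a::{field,finite})"
proof (cases "x = 0")
  case False
  define U where "U = UNIV - {0 :: 'a}"
  have "bij_betw ((*) x) U U"
    unfolding U_def using False by (intro bij_betw_byWitness[where f' = "\<lambda>y. y / x"]) auto
  then have "(\<Prod>y\<in>U. x * y) = (\<Prod>y\<in>U. y)"
    by (rule prod.reindex_bij_betw)
  then have "x ^ card U * (\<Prod>y\<in>U. y) = 1 * (\<Prod>y\<in>U. y)"
    by (simp only: prod.distrib prod_constant mult_1)
  moreover have "(\<Prod>y\<in>U. y) \<noteq> 0" by (simp add: U_def)
  ultimately have "x ^ card U = 1" by (simp only: mult_cancel_right) simp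
  moreover have "CARD('a) = Suc (card U)"
    unfolding U_def by (rule card.remove) simp_all
  ultimately show ?thesis by (simp only: power_Suc) simp
next
  case True
  then show ?thesis by (simp only: power_0_left) simp
qed

section \<open>The affine plane as a quadratic extension field\<close>

lemma degree_monom_diff:
  fixes r :: "'a::comm_ring_1 poly"
  assumes "degree r < m"
  shows "degree (monom 1 m - r) = m"
  using assms degree_add_eq_left[of "- r" "monom 1 m"] by (simp add: degree_monom_eq)

text \<open>The pair \<open>(a, b)\<close> is sent to \<open>a + b * \<omega>\<close> in the
  algebraic closure, with \<omega> of degree 2 over the ground field. Affine lines become the lines
  used in the locale.\<close>

theorem no_odd_maximal_arc_affine:
  fixes A :: "('a::{field,finite} \<times> 'a) set" and n e :: nat
  assumes char: "CHAR('a) > 2" and n: "n = CHAR('a) ^ e" "1 < n" "n < CARD('a)"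
    and card_A: "card A = (n - 1) * (CARD('a) + 1) + 1"
    and lines: "\<And>a b c. a \<noteq> 0 \<or> b \<noteq> 0 \<Longrightarrow> card {p \<in> A. a * fst p + b * snd p = c} \<in> {0, n}"
  shows False
proof -
  define q where "q = CARD('a)"
  obtain h where h: "q = CHAR('a) ^ h"
    using finite_field_card_eq_CHAR_power[where 'a = 'a] by (auto simp: q_def)
  have q1: "1 < q" using n by (simp add: q_def)
  have prime: "prime CHAR('a alg_closure)" using prime_CHAR_finite_field[where 'a = 'a] by simp
  have add_pow: "(x + y) ^ q = x ^ q + y ^ q" for x y :: "'a alg_closure"
    using prime h by (intro freshmans_dream'[where n = h]) auto
  have ac_pow: "to_ac x ^ q = to_ac x" for x :: 'a
    using finite_field_power_card[of x] by (simp add: q_def flip: to_ac_power)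
  have fixed: "{t :: 'a alg_closure. t ^ q = t} = range to_ac"
  proof (rule sym, rule card_seteq)
    let ?P = "monom 1 q - monom 1 1 :: 'a alg_closure poly"
    have deg: "degree ?P = q"
      using q1 by (intro degree_monom_diff) (simp add: degree_monom_eq)
    have eq: "{t :: 'a alg_closure. t ^ q = t} = {t. poly ?P t = 0}" by (auto simp: poly_monom)
    have P0: "?P \<noteq> 0" using deg q1 by auto
    show "finite {t :: 'a alg_closure. t ^ q = t}"
      unfolding eq by (rule poly_roots_finite[OF P0])
    have "card {t :: 'a alg_closure. t ^ q = t} \<le> q"
      unfolding eq using card_poly_roots_bound[OF P0] deg by simp
    also have "q = card (range (to_ac :: 'a \<Rightarrow> _))" by (simp add: q_def card_image inj_to_ac)
    finally show "card {t :: 'a alg_closure. t ^ q = t} \<le> card (range (to_ac :: 'a \<Rightarrow> _))" .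
    show "range to_ac \<subseteq> {t :: 'a alg_closure. t ^ q = t}" using ac_pow by auto
  qed
  \<comment> \<open>With \<open>c ^ q = - c\<close> and \<open>\<omega> ^ q = \<omega> + c\<close>,
    a second Frobenius step returns \<omega>, while \<open>c \<noteq> 0\<close> keeps \<omega> out
    of the ground field. This puts \<omega> in \<open>GF(q^2)\<close>.\<close>
  obtain c :: "'a alg_closure" where c: "c ^ (q - 1) = -1"
    using nth_root_exists[of "q - 1" "-1"] q1 by auto
  have "degree (monom 1 q - [:c, 1:]) = q"
    using q1 by (intro degree_monom_diff) simp
  then obtain \<omega> where \<omega>: "poly (monom 1 q - [:c, 1:]) \<omega> = 0"
    using alg_closed_imp_poly_has_root[of "monom 1 q - [:c, 1:]"] q1 by auto
  then have \<omega>q: "\<omega> ^ q = c + \<omega>" by (simp add: poly_monom)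
  have "c \<noteq> 0" using c q1 by (auto simp: power_0_left split: if_splits)
  then have \<omega>_notin: "\<omega> \<notin> range to_ac" using \<omega>q ac_pow by auto
  have "c ^ q = c * c ^ (q - 1)" using q1 by (metis Suc_diff_1 less_trans power_Suc zero_less_one)
  then have "\<omega> ^ (q ^ 2) = \<omega>"
    using \<omega>q c by (simp add: power2_eq_square power_mult add_pow)
  define \<phi> where "\<phi> = (\<lambda>p. to_ac (fst p) + to_ac (snd p) * \<omega>)"
  have \<phi>_eq0: "x = 0 \<and> y = 0" if "to_ac x + to_ac y * \<omega> = 0" for x y :: 'a
  proof -
    have "y = 0"
    proof (rule ccontr)
      assume "y \<noteq> 0"
      moreover have "\<omega> * to_ac y = to_ac (- x)"
        using that by (simp add: eq_neg_iff_add_eq_0 add.commute mult.commute)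
      ultimately have "\<omega> = to_ac (- x / y)"
        unfolding to_ac_divide by (subst nonzero_eq_divide_eq) simp_all
      then show False using \<omega>_notin by blast
    qed
    then show ?thesis using that by simp
  qed
  have inj: "inj \<phi>"
  proof (rule injI)
    fix p p' assume "\<phi> p = \<phi> p'"
    then have "to_ac (fst p - fst p') + to_ac (snd p - snd p') * \<omega> = 0"
      by (simp add: \<phi>_def algebra_simps)
    from \<phi>_eq0[OF this] show "p = p'" by (simp add: prod_eq_iff)
  qed
  interpret affine_maximal_arc "\<phi> ` A" "range \<phi>" q n e h
  proof
    show "prime CHAR('a alg_closure)" by (fact prime)
    show "2 < CHAR('a alg_closure)" "n = CHAR('a alg_closure) ^ e" "q = CHAR('a alg_closure) ^ h"
      using char n h by simp_all
    show "1 < n" "n < q" using n by (simp_all add: q_def)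
    show "card (range \<phi>) = q\<^sup>2"
      using card_image[OF inj] by (simp add: q_def power2_eq_square card_prod)
    show "\<phi> ` A \<subseteq> range \<phi>" by auto
    show "card (\<phi> ` A) = (n - 1) * (q + 1) + 1"
      using card_image[OF inj_on_subset[OF inj]] card_A by (simp add: q_def)
  next
    fix z assume "z \<in> range \<phi>"
    then obtain p where z: "z = to_ac (fst p) + to_ac (snd p) * \<omega>" by (auto simp: \<phi>_def)
    show "z ^ q\<^sup>2 = z"
      using \<open>\<omega> ^ (q ^ 2) = \<omega>\<close> unfolding z
      by (simp add: power2_eq_square power_mult add_pow power_mult_distrib ac_pow)
  next
    fix x y assume "x \<in> range \<phi>" "y \<in> range \<phi>"
    then obtain p p' where "x = \<phi> p" "y = \<phi> p'" by auto
    then have "x - y = \<phi> (fst p - fst p', snd p - snd p')" by (simp add: \<phi>_def algebra_simps)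
    then show "x - y \<in> range \<phi>" by blast
  next
    fix x z assume xz: "x \<in> range \<phi>" "z \<in> range \<phi>" "z \<noteq> 0"
    then obtain u v where u: "x = \<phi> u" and v1: "z = \<phi> v" by blast
    moreover have "v \<noteq> (0, 0)" using xz(3) v1 by (auto simp: \<phi>_def)
    ultimately have v: "z = \<phi> v" "v \<noteq> (0, 0)" by simp_all
    \<comment> \<open>The equation of the line through \<open>u\<close> with direction
      \<open>v\<close>.\<close>
    define L where "L = {p \<in> A. snd v * fst p + (- fst v) * snd p = snd v * fst u - fst v * snd u}"
    have "{b \<in> \<phi> ` A. \<exists>t. t ^ q = t \<and> b = x + t * z} = \<phi> ` L"
    proof (intro Set.set_eqI iffI)
      fix b assume "b \<in> {b \<in> \<phi> ` A. \<exists>t. t ^ q = t \<and> b = x + t * z}"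
      then obtain p t where p: "p \<in> A" "b = \<phi> p" and t: "t ^ q = t" "b = x + t * z" by blast
      have "t \<in> {t. t ^ q = t}" using t(1) by simp
      then obtain r where "t = to_ac r" unfolding fixed by (rule rangeE)
      then have "\<phi> p = \<phi> (fst u + r * fst v, snd u + r * snd v)"
        using p t u v by (simp add: \<phi>_def algebra_simps)
      then have "p = (fst u + r * fst v, snd u + r * snd v)" by (rule injD[OF inj])
      then have "fst p = fst u + r * fst v" "snd p = snd u + r * snd v" by simp_all
      then have "p \<in> L" using p(1) by (simp add: L_def algebra_simps)
      then show "b \<in> \<phi> ` L" using p by simp
    next
      fix b assume "b \<in> \<phi> ` L"
      then obtain p where p: "p \<in> A" "b = \<phi> p" and
        eq: "snd v * fst p - fst v * snd p = snd v * fst u - fst v * snd u" by (auto simp: L_def)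
      have eq': "snd v * (fst p - fst u) = fst v * (snd p - snd u)"
        using eq by (simp add: algebra_simps)
      define r where "r = (if fst v \<noteq> 0 then (fst p - fst u) / fst v else (snd p - snd u) / snd v)"
      have "fst p - fst u = r * fst v \<and> snd p - snd u = r * snd v"
      proof (cases "fst v = 0")
        case True
        then have "snd v \<noteq> 0" using v by (metis prod.collapse)
        then show ?thesis using True eq' by (simp add: r_def)
      next
        case False
        then have r: "r * fst v = fst p - fst u" by (simp add: r_def)
        have "fst v * (r * snd v) = snd v * (r * fst v)" by (simp only: ac_simps)
        also have "\<dots> = fst v * (snd p - snd u)" unfolding r by (rule eq')
        finally show ?thesis using False r by simp
      qed
      then have "fst p = fst u + r * fst v" "snd p = snd u + r * snd v"
        by (metis add_diff_cancel_left' diff_add_cancel add.commute)+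
      then have "b = x + to_ac r * z" using p u v by (simp add: \<phi>_def algebra_simps)
      then show "b \<in> {b \<in> \<phi> ` A. \<exists>t. t ^ q = t \<and> b = x + t * z}" using p ac_pow[of r] by blast
    qed
    then have "card {b \<in> \<phi> ` A. \<exists>t. t ^ q = t \<and> b = x + t * z} = card L"
      using card_image[OF inj_on_subset[OF inj]] by simp
    moreover have "snd v \<noteq> 0 \<or> - fst v \<noteq> 0" using v by (metis neg_equal_0_iff_equal prod.collapse)
    ultimately show "card {b \<in> \<phi> ` A. \<exists>t. t ^ q = t \<and> b = x + t * z} \<in> {0, n}"
      unfolding L_def using lines[of "snd v" "- fst v"] by simp
  qed
  show False by (rule no_affine_maximal_arc)
qed

section \<open>Maximal arcs in projective planes\<close>

text \<open>
  A finite projective plane of order \<open>q\<close> in which points and lines are both named by the elements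
  of \<open>Pts\<close>, via a polarity; the line named \<open>u\<close> is \<open>line u\<close>, and \<open>line x\<close> is also the pencil of lines
  through the point \<open>x\<close>.
\<close>

locale polar_plane =
  fixes Pts :: "'p set" and inc :: "'p \<Rightarrow> 'p \<Rightarrow> bool" and q :: nat
  assumes finite_Pts: "finite Pts"
    and inc_sym: "inc x y \<longleftrightarrow> inc y x"
    and join: "x \<in> Pts \<Longrightarrow> y \<in> Pts \<Longrightarrow> x \<noteq> y \<Longrightarrow> (\<exists>!z. z \<in> Pts \<and> inc z x \<and> inc z y)"
    and card_line: "u \<in> Pts \<Longrightarrow> card {x \<in> Pts. inc u x} = q + 1"
begin

definition line :: "'p \<Rightarrow> 'p set" where
  "line u = {x \<in> Pts. inc u x}"

lemma finite_line: "finite (line u)" and line_subset: "line u \<subseteq> Pts"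
  using finite_Pts by (auto simp: line_def)

lemma mem_line_sym: "x \<in> Pts \<Longrightarrow> u \<in> Pts \<Longrightarrow> x \<in> line u \<longleftrightarrow> u \<in> line x"
  by (auto simp: line_def inc_sym)

text \<open>Each point other than \<open>p\<close> lies on exactly one line through
  \<open>p\<close>. Indexing by \<open>I\<close> counts points with multiplicity, since
  \<open>v\<close> may repeat values.\<close>

lemma pencil_sum:
  fixes v :: "'i \<Rightarrow> 'p"
  assumes p: "p \<in> Pts" and I: "finite I" "\<And>i. i \<in> I \<Longrightarrow> v i \<in> Pts"
  shows "(\<Sum>u\<in>line p. card {i \<in> I. v i \<in> line u \<and> v i \<noteq> p}) = card {i \<in> I. v i \<noteq> p}"
proof -
  have "{i \<in> I. v i \<noteq> p} = (\<Union>u\<in>line p. {i \<in> I. v i \<in> line u \<and> v i \<noteq> p})"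
  proof (intro Set.set_eqI iffI)
    fix i assume i: "i \<in> {i \<in> I. v i \<noteq> p}"
    then obtain z where "z \<in> Pts" "inc z (v i)" "inc z p" using join[of "v i" p] p I by auto
    then show "i \<in> (\<Union>u\<in>line p. {i \<in> I. v i \<in> line u \<and> v i \<noteq> p})"
      using i I inc_sym by (auto simp: line_def)
  qed auto
  also have "card \<dots> = (\<Sum>u\<in>line p. card {i \<in> I. v i \<in> line u \<and> v i \<noteq> p})"
  proof (rule card_UN_disjoint)
    show "\<forall>u\<in>line p. \<forall>u'\<in>line p. u \<noteq> u' \<longrightarrow>
        {i \<in> I. v i \<in> line u \<and> v i \<noteq> p} \<inter> {i \<in> I. v i \<in> line u' \<and> v i \<noteq> p} = {}"
    proof (intro ballI impI equals0I)
      fix u u' i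
      assume u: "u \<in> line p" "u' \<in> line p" "u \<noteq> u'"
        and "i \<in> {i \<in> I. v i \<in> line u \<and> v i \<noteq> p} \<inter> {i \<in> I. v i \<in> line u' \<and> v i \<noteq> p}"
      then have i: "v i \<in> Pts" "v i \<noteq> p" "inc u (v i)" "inc u' (v i)" by (auto simp: line_def)
      moreover have "inc u p" "inc u' p" "u \<in> Pts" "u' \<in> Pts" using u inc_sym by (auto simp: line_def)
      ultimately show False using join[of "v i" p] p u(3) by blast
    qed
  qed (use I finite_line in auto)
  finally show ?thesis by simp
qed

lemma pencil_sum_set:
  assumes "p \<in> Pts" "K \<subseteq> Pts"
  shows "(\<Sum>u\<in>line p. card (K \<inter> line u - {p})) = card (K - {p})"
proof -
  have "finite K" using assms finite_Pts by (auto intro: finite_subset)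
  moreover have "{i \<in> K. i \<in> line u \<and> i \<noteq> p} = K \<inter> line u - {p}" for u by auto
  moreover have "{i \<in> K. i \<noteq> p} = K - {p}" by auto
  ultimately show ?thesis using pencil_sum[OF assms(1), of K "\<lambda>i. i"] assms(2) by auto
qed

lemma card_pencil: "p \<in> Pts \<Longrightarrow> card (line p) = q + 1"
  unfolding line_def by (rule card_line)

lemma card_Pts: assumes "Pts \<noteq> {}" shows "card Pts = (q + 1) * q + 1"
proof -
  obtain p where p: "p \<in> Pts" using assms by auto
  have "card (Pts \<inter> line u - {p}) = q" if "u \<in> line p" for u
  proof -
    have u: "u \<in> Pts" "p \<in> line u" using that p by (auto simp: line_def inc_sym)
    moreover have "Pts \<inter> line u = line u" by (auto simp: line_def)
    ultimately show ?thesis using finite_line[of u] card_pencil[of u] by simp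
  qed
  then have "card (Pts - {p}) = (q + 1) * q"
    using pencil_sum_set[OF p order_refl] card_pencil[OF p] by simp
  then show ?thesis using p finite_Pts card_Suc_Diff1[of Pts p] by simp
qed

definition maximal_arc :: "nat \<Rightarrow> 'p set \<Rightarrow> bool" where
  "maximal_arc m K \<longleftrightarrow> K \<subseteq> Pts \<and> card K = (m - 1) * (q + 1) + 1 \<and> (\<forall>u\<in>Pts. card (K \<inter> line u) \<in> {0, m})"

text \<open>A point of multiplicity \<open>M \<ge> 2\<close> leaves room for at most
  \<open>m - M\<close> others on each of its \<open>q + 1\<close> lines. The total
  \<open>M + (q + 1) * (m - M)\<close> is then below \<open>(m - 1) * (q + 1)\<close>.\<close>

lemma arc_inj:
  fixes v :: "'i \<Rightarrow> 'p"
  assumes I: "finite I" "\<And>i. i \<in> I \<Longrightarrow> v i \<in> Pts" and q: "2 \<le> q"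
    and m: "\<And>u. u \<in> Pts \<Longrightarrow> card {i \<in> I. v i \<in> line u} \<le> m"
    and large: "(m - 1) * (q + 1) \<le> card I" and "2 \<le> m"
  shows "inj_on v I"
proof (rule inj_onI, rule ccontr)
  fix i j assume ij: "i \<in> I" "j \<in> I" "v i = v j" "i \<noteq> j"
  let ?p = "v i"
  define M where "M = {k \<in> I. v k = ?p}"
  have p: "?p \<in> Pts" using ij I by simp
  have "card {i, j} \<le> card M" unfolding M_def using ij I by (intro card_mono) auto
  then have M2: "2 \<le> card M" using ij by simp
  have le: "card M + card {k \<in> I. v k \<in> line u \<and> v k \<noteq> ?p} \<le> m" if u: "u \<in> line ?p" for u
  proof -
    have "u \<in> Pts" "?p \<in> line u" using u p by (auto simp: line_def inc_sym)
    then have "{k \<in> I. v k \<in> line u} = M \<union> {k \<in> I. v k \<in> line u \<and> v k \<noteq> ?p}"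
      unfolding M_def by auto
    moreover have "card (M \<union> {k \<in> I. v k \<in> line u \<and> v k \<noteq> ?p})
        = card M + card {k \<in> I. v k \<in> line u \<and> v k \<noteq> ?p}"
      using I unfolding M_def by (intro card_Un_disjoint) auto
    ultimately show ?thesis using m[OF \<open>u \<in> Pts\<close>] by simp
  qed
  have "card I = card M + card {k \<in> I. v k \<noteq> ?p}"
    using I unfolding M_def by (subst card_Un_disjoint[symmetric]) (auto intro: arg_cong[of _ _ card])
  also have "card {k \<in> I. v k \<noteq> ?p} = (\<Sum>u\<in>line ?p. card {k \<in> I. v k \<in> line u \<and> v k \<noteq> ?p})"
    using pencil_sum[OF p I(1), of v] I(2) by simp
  also have "\<dots> \<le> (\<Sum>u\<in>line ?p. m - card M)"
  proof (rule sum_mono)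
    fix u assume "u \<in> line ?p"
    then show "card {k \<in> I. v k \<in> line u \<and> v k \<noteq> ?p} \<le> m - card M" using le[of u] by linarith
  qed
  finally have bound: "card I \<le> card M + (q + 1) * (m - card M)" using card_pencil[OF p] by simp
  have "line ?p \<noteq> {}" using card_pencil[OF p] by auto
  then have "card M \<le> m" using le by fastforce
  then obtain r where r: "m = card M + r" using le_Suc_ex by blast
  have "(card M - 1 + r) * (q + 1) \<le> card M + (q + 1) * r"
    using large bound r M2 by simp
  then have "(card M - 1) * (q + 1) \<le> card M" by (simp add: algebra_simps)
  moreover obtain c where "card M = Suc (Suc c)" using M2 by (metis add_2_eq_Suc le_Suc_ex)
  ultimately show False using q by auto
qed

text \<open>Around a point \<open>p\<close> of \<open>K\<close> on \<open>u\<close>, the other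
  \<open>q\<close> lines hold at most \<open>q * (m - 1)\<close> further points, so the cardinality
  forces \<open>m - 1\<close> further points onto \<open>u\<close>.\<close>

lemma maximal_arcI:
  assumes K: "K \<subseteq> Pts" and m: "\<And>u. u \<in> Pts \<Longrightarrow> card (K \<inter> line u) \<le> m"
    and c: "card K = (m - 1) * (q + 1) + 1" and "1 \<le> m"
  shows "maximal_arc m K"
  unfolding maximal_arc_def
proof (intro conjI ballI)
  have fin: "finite K" using K finite_Pts by (rule finite_subset)
  fix u assume u: "u \<in> Pts"
  show "card (K \<inter> line u) \<in> {0, m}"
  proof (cases "K \<inter> line u = {}")
    case False
    then obtain p where p: "p \<in> K" "p \<in> line u" by auto
    have pX: "p \<in> Pts" using p K by auto
    have le: "card (K \<inter> line w - {p}) \<le> m - 1" if "w \<in> line p" for w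
    proof -
      have "w \<in> Pts" "p \<in> line w" using that pX by (auto simp: line_def inc_sym)
      then show ?thesis using m[of w] p fin by simp
    qed
    have uL: "u \<in> line p" using p u pX mem_line_sym by blast
    have "(m - 1) * (q + 1) = (\<Sum>w\<in>line p. card (K \<inter> line w - {p}))"
      using pencil_sum_set[OF pX K] c p fin by simp
    also have "\<dots> = card (K \<inter> line u - {p}) + (\<Sum>w\<in>line p - {u}. card (K \<inter> line w - {p}))"
      using uL finite_line by (intro sum.remove)
    also have "(\<Sum>w\<in>line p - {u}. card (K \<inter> line w - {p})) \<le> (\<Sum>w\<in>line p - {u}. m - 1)"
      using le by (intro sum_mono) auto
    also have "\<dots> = q * (m - 1)" using card_pencil[OF pX] uL finite_line by simp
    finally have "m - 1 \<le> card (K \<inter> line u - {p})"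
      by (simp only: distrib_left mult.commute[of q] mult_1_right add_le_cancel_right) linarith
    moreover have "0 < card (K \<inter> line u)" using False fin by (simp add: card_gt_0_iff)
    ultimately have "m \<le> card (K \<inter> line u)" using p fin by (simp add: card_Diff_singleton)
    then show ?thesis using m[OF u] by simp
  qed simp
qed (use K c in auto)

lemma arc_card_le:
  assumes K: "K \<subseteq> Pts" "K \<noteq> {}" and m: "\<And>u. u \<in> Pts \<Longrightarrow> card (K \<inter> line u) \<le> m"
  shows "card K \<le> (m - 1) * (q + 1) + 1"
proof -
  have fin: "finite K" using K finite_Pts by (blast intro: finite_subset)
  obtain p where p: "p \<in> K" using K by auto
  then have pX: "p \<in> Pts" using K by auto
  have le: "card (K \<inter> line w - {p}) \<le> m - 1" if "w \<in> line p" for w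
  proof -
    have "w \<in> Pts" "p \<in> line w" using that pX by (auto simp: line_def inc_sym)
    then show ?thesis using m[of w] p fin by simp
  qed
  have "card (K - {p}) \<le> (\<Sum>w\<in>line p. m - 1)"
    unfolding pencil_sum_set[OF pX K(1), symmetric] using le by (rule sum_mono)
  then show ?thesis using card_pencil[OF pX] p fin by (simp add: algebra_simps)
qed


text \<open>Let \<open>S\<close> be the lines with \<open>m - 1\<close> points of \<open>K\<close>.
  The proof shows that \<open>S\<close> consists of \<open>q + 1\<close> lines and covers every
  point, and that such a set of lines is a pencil; its centre \<open>P\<close> is the missing
  point.\<close>

lemma deficient_arc_extends:
  assumes K: "K \<subseteq> Pts" and m: "\<And>u. u \<in> Pts \<Longrightarrow> card (K \<inter> line u) \<le> m"
    and c: "card K = (m - 1) * (q + 1)" and m3: "3 \<le> m" "m < q"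
  shows "\<exists>P. maximal_arc m (insert P K)"
proof -
  have fin: "finite K" using K finite_Pts by (rule finite_subset)
  define S where "S = {u \<in> Pts. card (K \<inter> line u) = m - 1}"
  have SP: "S \<subseteq> Pts" and finS: "finite S" using finite_Pts by (auto simp: S_def)
  define \<sigma> where "\<sigma> = (\<lambda>x. card (S \<inter> line x))"
  \<comment> \<open>The shortfalls below \<open>m\<close> on the lines through \<open>p\<close> add
    up to 1, so exactly one of these lines is short.\<close>
  have pencil_K: "(\<exists>s. S \<inter> line p = {s}) \<and> (\<forall>u\<in>line p - S. card (K \<inter> line u) = m)" if p: "p \<in> K" for p
  proof -
    have pX: "p \<in> Pts" using p K by auto
    define f where "f = (\<lambda>u. m - card (K \<inter> line u))"
    have cK: "card (K \<inter> line u - {p}) = card (K \<inter> line u) - 1" "1 \<le> card (K \<inter> line u)"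
      "card (K \<inter> line u) \<le> m" if "u \<in> line p" for u
    proof -
      have u: "u \<in> Pts" "p \<in> line u" using that pX by (auto simp: line_def inc_sym)
      show "card (K \<inter> line u - {p}) = card (K \<inter> line u) - 1" using u p fin by simp
      have "K \<inter> line u \<noteq> {}" using u p by auto
      then show "1 \<le> card (K \<inter> line u)" using fin by (simp add: Suc_le_eq card_gt_0_iff)
      show "card (K \<inter> line u) \<le> m" using m u by simp
    qed
    have "(\<Sum>u\<in>line p. card (K \<inter> line u - {p})) + (\<Sum>u\<in>line p. f u) = (\<Sum>u\<in>line p. m - 1)"
      unfolding sum.distrib[symmetric] f_def using cK by (intro sum.cong) auto
    then have "card (K - {p}) + (\<Sum>u\<in>line p. f u) = card K"
      unfolding pencil_sum_set[OF pX K] using card_pencil[OF pX] c by (simp add: algebra_simps)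
    then have sum1: "(\<Sum>u\<in>line p. f u) = 1"
      using p fin by (metis add_left_cancel card_Suc_Diff1 Suc_eq_plus1)
    then obtain s where s: "s \<in> line p" "f s = 1" "\<forall>u\<in>line p. u \<noteq> s \<longrightarrow> f u = 0"
      using sum_eq_1_iff[OF finite_line, of f p] by auto
    have S_iff: "u \<in> S \<longleftrightarrow> f u = 1" if "u \<in> line p" for u
      using that cK[OF that] m3 by (auto simp: S_def f_def line_def)
    have "S \<inter> line p = {s}" using s S_iff by auto
    moreover have "card (K \<inter> line u) = m" if "u \<in> line p - S" for u
    proof -
      have "f u = 0" using that s S_iff by auto
      then show ?thesis using cK(3)[of u] that by (simp add: f_def)
    qed
    ultimately show ?thesis by blast
  qed
  have \<sigma>_K: "\<sigma> p = 1" if "p \<in> K" for p using pencil_K[OF that] by (auto simp: \<sigma>_def)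
  have sizes: "card (K \<inter> line u) \<in> {0, m}" if u: "u \<in> Pts" "u \<notin> S" for u
  proof (cases "K \<inter> line u = {}")
    case False
    then obtain p where p: "p \<in> K" "p \<in> line u" by auto
    then have "u \<in> line p" using u K mem_line_sym by blast
    then show ?thesis using pencil_K[OF p(1)] u by blast
  qed simp
  \<comment> \<open>Incidences of \<open>K\<close> with \<open>S\<close> are counted twice: one
    short line per point, \<open>m - 1\<close> points per short line.\<close>
  have cardS: "card S = q + 1"
  proof -
    have "card K = (\<Sum>p\<in>K. \<sigma> p)" using \<sigma>_K by simp
    also have "\<dots> = (\<Sum>p\<in>K. \<Sum>u\<in>S. if u \<in> line p then 1 else 0)"
      unfolding \<sigma>_def using finS by (simp add: sum.If_cases Int_def)
    also have "\<dots> = (\<Sum>u\<in>S. \<Sum>p\<in>K. if u \<in> line p then 1 else 0)" by (rule sum.swap)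
    also have "\<dots> = (\<Sum>u\<in>S. card (K \<inter> line u))"
    proof (intro sum.cong refl)
      fix u assume "u \<in> S"
      then have "(\<Sum>p\<in>K. if u \<in> line p then 1 else 0) = (\<Sum>p\<in>K. if p \<in> line u then 1 else (0::nat))"
        using SP K mem_line_sym by (intro sum.cong) auto
      then show "(\<Sum>p\<in>K. if u \<in> line p then 1 else 0) = card (K \<inter> line u)"
        using fin by (simp add: sum.If_cases Int_def)
    qed
    also have "\<dots> = card S * (m - 1)" by (simp add: S_def)
    finally have "(q + 1) * (m - 1) = card S * (m - 1)" unfolding c by (simp only: mult.commute)
    then show ?thesis using m3 unfolding mult_cancel2 by linarith
  qed
  \<comment> \<open>Each of the \<open>q + 1\<close> short lines meets another line \<open>u\<close>
    in exactly one point.\<close>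
  have on_line: "(\<Sum>x\<in>line u. \<sigma> x) = q + 1" if u: "u \<in> Pts" "u \<notin> S" for u
  proof -
    have "S \<inter> line x - {u} = S \<inter> line x" for x using u by auto
    then show ?thesis using pencil_sum_set[OF u(1) SP] u cardS by (simp add: \<sigma>_def)
  qed
  \<comment> \<open>Counting \<open>K\<close> along the pencil of \<open>x\<close> gives
    \<open>(m - 1) * (q + 1 - \<sigma> x)\<close> as a sum of line sizes 0 or \<open>m\<close>, and
    \<open>m - 1\<close> is coprime to \<open>m\<close>.\<close>
  have dvd: "m dvd q + 1 - \<sigma> x" "\<sigma> x \<le> q + 1" if x: "x \<in> Pts" "x \<notin> K" for x
  proof -
    show le: "\<sigma> x \<le> q + 1"
      unfolding \<sigma>_def using card_pencil[OF x(1)] card_mono[OF finite_line, of "S \<inter> line x" x] by simp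
    have "card K = (\<Sum>u\<in>line x. card (K \<inter> line u))"
      using pencil_sum_set[OF x(1) K] x by simp
    also have "\<dots> = (\<Sum>u\<in>line x \<inter> S. card (K \<inter> line u)) + (\<Sum>u\<in>line x - S. card (K \<inter> line u))"
      by (rule sum.Int_Diff[OF finite_line])
    also have "(\<Sum>u\<in>line x \<inter> S. card (K \<inter> line u)) = \<sigma> x * (m - 1)"
      by (simp add: \<sigma>_def S_def Int_commute)
    finally have eq: "(m - 1) * (q + 1 - \<sigma> x) = (\<Sum>u\<in>line x - S. card (K \<inter> line u))"
      using c by (simp add: diff_mult_distrib2 mult.commute)
    have "m dvd (\<Sum>u\<in>line x - S. card (K \<inter> line u))"
      using sizes line_subset by (intro dvd_sum) fastforce
    then have "m dvd (m - 1) * (q + 1 - \<sigma> x)" unfolding eq .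
    moreover have "coprime m (m - 1)" using m3 coprime_Suc_left_nat[of "m - 1"] by simp
    ultimately show "m dvd q + 1 - \<sigma> x" by (simp add: coprime_dvd_mult_right_iff)
  qed
  have q_dvd: "m dvd q"
  proof -
    have "K \<noteq> {}" using c m3 by auto
    then obtain p where p: "p \<in> K" by auto
    have pX: "p \<in> Pts" using p K by auto
    obtain s where s: "S \<inter> line p = {s}" using pencil_K[OF p] by auto
    have "\<not> line p \<subseteq> {s}"
      using card_pencil[OF pX] m3 card_mono[of "{s}" "line p"] by auto
    then obtain u where u: "u \<in> line p - S" using s by auto
    have uX: "u \<in> Pts" using u line_subset by auto
    have full: "card (K \<inter> line u) = m" using pencil_K[OF p] u by auto
    \<comment> \<open>The \<open>m\<close> points of \<open>K\<close> on \<open>u\<close> use up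
      \<open>m\<close> of the total \<open>q + 1\<close>, so the remaining \<open>q + 1 - m\<close>
      points have average 1.\<close>
    have "\<exists>y\<in>line u - K. \<sigma> y \<le> 1"
    proof (rule ccontr)
      assume neg: "\<not> ?thesis"
      have big: "2 \<le> \<sigma> y" if "y \<in> line u - K" for y
      proof -
        have "\<not> \<sigma> y \<le> 1" using neg that by blast
        then show ?thesis by simp
      qed
      have "q + 1 = (\<Sum>x\<in>line u \<inter> K. \<sigma> x) + (\<Sum>x\<in>line u - K. \<sigma> x)"
        using on_line[of u] u uX sum.Int_Diff[OF finite_line, of \<sigma> u K] by simp
      also have "(\<Sum>x\<in>line u \<inter> K. \<sigma> x) = m" using \<sigma>_K full by (simp add: Int_commute)
      finally have "q + 1 = m + (\<Sum>x\<in>line u - K. \<sigma> x)" .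
      moreover have "(\<Sum>x\<in>line u - K. 2) \<le> (\<Sum>x\<in>line u - K. \<sigma> x)" using big by (rule sum_mono)
      moreover have "card (line u - K) = q + 1 - m"
        using full card_pencil[OF uX] finite_line[of u]
        by (metis Diff_Int_distrib Int_commute card_Diff_subset_Int finite_Int)
      ultimately show False using m3 by simp
    qed
    then obtain y where y: "y \<in> line u - K" "\<sigma> y \<le> 1" by auto
    have yX: "y \<in> Pts" "y \<notin> K" using y line_subset by auto
    show ?thesis
    proof (cases "\<sigma> y = 1")
      case True
      then show ?thesis using dvd(1)[OF yX] by simp
    next
      case False
      then have "\<sigma> y = 0" using y(2) by linarith
      \<comment> \<open>If \<open>m\<close> divided \<open>q + 1\<close>, every point off
        \<open>K\<close> on a short line \<open>s\<close> would lie on at least \<open>m\<close>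
        short lines. There are \<open>q + 2 - m\<close> such points, too many for the
        \<open>q\<close> short lines other than \<open>s\<close>.\<close>
      then have dq1: "m dvd q + 1" using dvd(1)[OF yX] by simp
      have "S \<noteq> {}" using cardS by auto
      then obtain s where s: "s \<in> S" by auto
      have sX: "s \<in> Pts" using s SP by auto
      have ge: "m - 1 \<le> card (S \<inter> line x - {s})" if x: "x \<in> line s - K" for x
      proof -
        have xX: "x \<in> Pts" "x \<notin> K" using x line_subset by auto
        have sx: "s \<in> S \<inter> line x" using x s sX xX mem_line_sym by blast
        then have pos: "0 < \<sigma> x" unfolding \<sigma>_def using finS card_gt_0_iff by blast
        have "m dvd \<sigma> x" using dvd[OF xX] dq1 by (metis dvd_diffD1)
        then have "m \<le> \<sigma> x" using pos by (rule dvd_imp_le)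
        then show ?thesis using sx finS by (simp add: \<sigma>_def)
      qed
      have "card (line s \<inter> K) = m - 1" using s by (simp add: S_def Int_commute)
      then have "card (line s - K) = q + 1 - (m - 1)"
        using card_pencil[OF sX] finite_line[of s] by (simp add: card_Diff_subset_Int)
      then have "(q + 1 - (m - 1)) * (m - 1) = (\<Sum>x\<in>line s - K. m - 1)" by simp
      also have "\<dots> \<le> (\<Sum>x\<in>line s - K. card (S \<inter> line x - {s}))" using ge by (rule sum_mono)
      also have "\<dots> \<le> (\<Sum>x\<in>line s. card (S \<inter> line x - {s}))"
        using finite_line by (intro sum_mono2) auto
      also have "\<dots> = q" using pencil_sum_set[OF sX SP] s cardS finS by simp
      finally have le: "(q + 1 - (m - 1)) * (m - 1) \<le> q" .
      obtain a where a: "q = m + 1 + a" using m3 by (metis Suc_eq_plus1 Suc_leI le_Suc_ex)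
      obtain b where b: "m = 3 + b" using m3 le_Suc_ex by blast
      have False using le unfolding a b by (simp add: algebra_simps)
      then show ?thesis ..
    qed
  qed
  have \<sigma>_pos: "1 \<le> \<sigma> x" if x: "x \<in> Pts" for x
  proof (cases "x \<in> K")
    case False
    have "\<not> m dvd q + 1"
    proof
      assume "m dvd q + 1"
      then have "m dvd 1" using q_dvd dvd_add_right_iff by blast
      then show False using m3 by simp
    qed
    then show ?thesis using dvd(1)[OF x False] by (cases "\<sigma> x = 0") auto
  qed (simp add: \<sigma>_K)
  obtain s t where st: "s \<in> S" "t \<in> S" "s \<noteq> t"
  proof -
    have "\<not> card S \<le> 1" using cardS m3 by simp
    then show ?thesis using that by (metis card_le_Suc0_iff_eq finS One_nat_def)
  qed
  then obtain P where P: "P \<in> Pts" "inc P s" "inc P t" using join[of s t] SP by blast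
  have stP: "s \<in> line P" "t \<in> line P" using P st SP by (auto simp: line_def)
  have "2 \<le> \<sigma> P"
    unfolding \<sigma>_def using stP st finS card_mono[of "S \<inter> line P" "{s, t}"] by simp
  \<comment> \<open>A line through \<open>P\<close> outside \<open>S\<close> would have total
    \<open>q + 1\<close> over its \<open>q + 1\<close> points, each contributing at least 1 and
    \<open>P\<close> at least 2.\<close>
  have sub: "line P \<subseteq> S"
  proof (rule subsetI, rule ccontr)
    fix u assume u: "u \<in> line P" "u \<notin> S"
    have uX: "u \<in> Pts" "P \<in> line u" using u P line_subset mem_line_sym by auto
    have "q + 1 = \<sigma> P + (\<Sum>x\<in>line u - {P}. \<sigma> x)"
      using on_line[OF uX(1) u(2)] sum.remove[OF finite_line uX(2), of \<sigma>] by simp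
    moreover have "(\<Sum>x\<in>line u - {P}. 1) \<le> (\<Sum>x\<in>line u - {P}. \<sigma> x)"
      using \<sigma>_pos line_subset by (intro sum_mono) auto
    moreover have "card (line u - {P}) = q" using card_pencil[OF uX(1)] uX(2) finite_line by simp
    ultimately show False using \<open>2 \<le> \<sigma> P\<close> by simp
  qed
  then have S_eq: "line P = S"
    using card_pencil[OF P(1)] cardS finS by (intro card_subset_eq) auto
  have "P \<notin> K" using \<sigma>_K[of P] \<open>2 \<le> \<sigma> P\<close> by auto
  have "maximal_arc m (insert P K)"
    unfolding maximal_arc_def
  proof (intro conjI ballI)
    show "insert P K \<subseteq> Pts" using P K by auto
    show "card (insert P K) = (m - 1) * (q + 1) + 1" using \<open>P \<notin> K\<close> fin c by simp
    fix u assume u: "u \<in> Pts"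
    show "card (insert P K \<inter> line u) \<in> {0, m}"
    proof (cases "u \<in> S")
      case True
      then have "P \<in> line u" using S_eq u P mem_line_sym by blast
      then have "insert P K \<inter> line u = insert P (K \<inter> line u)" by auto
      then show ?thesis using True \<open>P \<notin> K\<close> fin m3 by (simp add: S_def)
    next
      case False
      then have "P \<notin> line u" using S_eq u P mem_line_sym by blast
      then have "insert P K \<inter> line u = K \<inter> line u" by auto
      then show ?thesis using sizes[OF u False] by simp
    qed
  qed
  then show ?thesis ..
qed

lemma large_arc_gives_maximal_arc:
  assumes K: "K \<subseteq> Pts" and m: "\<And>u. u \<in> Pts \<Longrightarrow> card (K \<inter> line u) \<le> m"
    and c: "(m - 1) * (q + 1) \<le> card K" and m3: "3 \<le> m" "m < q"
  shows "\<exists>K'. maximal_arc m K'"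
proof -
  have "K \<noteq> {}" using c m3 by auto
  then have "card K \<le> (m - 1) * (q + 1) + 1" using arc_card_le[OF K _ m] by blast
  then consider "card K = (m - 1) * (q + 1) + 1" | "card K = (m - 1) * (q + 1)" using c by linarith
  then show ?thesis
  proof cases
    case 1
    then show ?thesis using maximal_arcI[OF K m] m3 by auto
  next
    case 2
    then show ?thesis using deficient_arc_extends[OF K m] m3 by blast
  qed
qed

text \<open>Seen from a point \<open>y\<close> off \<open>K\<close>, all lines carry 0 or
  \<open>m\<close> points, so \<open>m\<close> divides \<open>card K = m * (q + 1) - q\<close>. If
  no line were external, the count would be \<open>m * (q + 1)\<close>.\<close>

lemma maximal_arc_dvd_and_external_line:
  assumes arc: "maximal_arc m K" and m: "1 < m" "m < q" and ne: "Pts \<noteq> {}"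
  shows "m dvd q" "\<exists>u\<in>Pts. K \<inter> line u = {}"
proof -
  have K: "K \<subseteq> Pts" and c: "card K = (m - 1) * (q + 1) + 1"
    and L: "\<And>u. u \<in> Pts \<Longrightarrow> card (K \<inter> line u) \<in> {0, m}"
    using arc by (auto simp: maximal_arc_def)
  have fin: "finite K" using K finite_Pts by (rule finite_subset)
  have "(m - 1) * (q + 1) < (q + 1) * q" 
    unfolding mult.commute[of "m - 1"] using m by (intro mult_strict_left_mono) auto
  then have "card K < card Pts" using card_Pts[OF ne] c by simp
  then obtain y where y: "y \<in> Pts" "y \<notin> K" using K finite_Pts by (metis card_mono not_less subsetI fin)
  have sum: "(\<Sum>u\<in>line y. card (K \<inter> line u)) = card K"
    using pencil_sum_set[OF y(1) K] y by simp
  have cq: "card K + q = m * (q + 1)" using c m by (cases m) auto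
  have "m dvd card K" unfolding sum[symmetric] using L line_subset by (intro dvd_sum) fastforce
  then show "m dvd q" using cq by (metis dvd_add_right_iff dvd_triv_left)
  show "\<exists>u\<in>Pts. K \<inter> line u = {}"
  proof (rule ccontr)
    assume "\<not> ?thesis"
    then have "card (K \<inter> line u) = m" if "u \<in> line y" for u
      using that L[of u] line_subset fin by auto
    then have "card K = (q + 1) * m" using sum card_pencil[OF y(1)] by simp
    then show False using cq m by (simp add: mult.commute)
  qed
qed

end

section \<open>Coordinates for the projective plane over a finite field\<close>

fun dot3 :: "'a::field \<times> 'a \<times> 'a \<Rightarrow> 'a \<times> 'a \<times> 'a \<Rightarrow> 'a" where
  "dot3 (a, b, c) (x, y, z) = a * x + b * y + c * z"

fun cross_prod :: "'a::field \<times> 'a \<times> 'a \<Rightarrow> 'a \<times> 'a \<times> 'a \<Rightarrow> 'a \<times> 'a \<times> 'a" where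
  "cross_prod (a, b, c) (x, y, z) = (b * z - c * y, c * x - a * z, a * y - b * x)"

text \<open>Representatives whose first nonzero coordinate is 1; they serve both for points and,
  through \<open>dot3\<close>, for lines.\<close>

definition pg2 :: "('a::field \<times> 'a \<times> 'a) set" where
  "pg2 = range (\<lambda>(y, z). (1, y, z)) \<union> range (\<lambda>z. (0, 1, z)) \<union> {(0, 0, 1)}"

text \<open>The zero vector goes to \<open>(0, 0, 1)\<close>, so that all values lie in
  \<open>pg2\<close>.\<close>

fun normalize3 :: "'a::field \<times> 'a \<times> 'a \<Rightarrow> 'a \<times> 'a \<times> 'a" where
  "normalize3 (x, y, z) = (if x \<noteq> 0 then (1, y / x, z / x) else if y \<noteq> 0 then (0, 1, z / y) else (0, 0, 1))"

lemma pg2_cases: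
  assumes "p \<in> pg2"
  obtains y z where "p = (1, y, z)" | z where "p = (0, 1, z)" | "p = (0, 0, 1)"
  using assms by (auto simp: pg2_def)

lemma pg2_intros [simp]: "(1, y, z) \<in> pg2" "(0, 1, z) \<in> pg2" "(0, 0, 1) \<in> pg2"
  by (auto simp: pg2_def)

lemma pg2_nonzero: "p \<in> pg2 \<Longrightarrow> p \<noteq> (0, 0, 0)"
  by (auto elim: pg2_cases)

lemma normalize3_in_pg2: "normalize3 v \<in> pg2"
  by (cases v) auto

lemma normalize3_scales:
  assumes "v \<noteq> (0, 0, 0)"
  obtains r where "r \<noteq> 0" "\<And>w. dot3 w v = r * dot3 w (normalize3 v)"
proof -
  obtain x y z where v: "v = (x, y, z)" by (cases v)
  define r where "r = (if x \<noteq> 0 then x else if y \<noteq> 0 then y else z)"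
  have "r \<noteq> 0" using assms by (auto simp: r_def v)
  moreover have "dot3 w v = r * dot3 w (normalize3 v)" for w
    by (cases w) (auto simp: r_def v distrib_left)
  ultimately show ?thesis by (rule that)
qed

lemma dot3_normalize3: "v \<noteq> (0, 0, 0) \<Longrightarrow> dot3 w (normalize3 v) = 0 \<longleftrightarrow> dot3 w v = 0"
  by (metis mult_eq_0_iff normalize3_scales)

lemma dot3_commute: "dot3 u v = dot3 v u"
  by (cases u; cases v) (simp add: ac_simps)

lemma eq_normalize3_of_cross_prod_zero:
  assumes "p \<in> pg2" "v \<noteq> (0, 0, 0)" "cross_prod p v = (0, 0, 0)"
  shows "p = normalize3 v"
proof -
  obtain x y z where v: "v = (x, y, z)" by (cases v)
  show ?thesis using assms(1)
  proof (cases rule: pg2_cases)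
    case (1 b c)
    then have "y = b * x" "z = c * x" using assms(3) by (auto simp: v)
    then show ?thesis using assms(2) 1 by (auto simp: v)
  next
    case (2 c)
    then have "x = 0" "z = c * y" using assms(3) by (auto simp: v)
    then show ?thesis using assms(2) 2 by (auto simp: v)
  next
    case 3
    then show ?thesis using assms by (auto simp: v)
  qed
qed

lemma normalize3_pg2: "p \<in> pg2 \<Longrightarrow> normalize3 p = p"
  by (auto elim: pg2_cases)

lemma cross_prod_eq_0_imp_eq:
  assumes "p \<in> pg2" "r \<in> pg2" "cross_prod p r = (0, 0, 0)"
  shows "p = r"
  using eq_normalize3_of_cross_prod_zero[OF assms(1) pg2_nonzero[OF assms(2)] assms(3)]
  by (simp add: normalize3_pg2 assms)

lemma dot3_cross_prod: "dot3 u (cross_prod u v) = 0" "dot3 v (cross_prod u v) = 0"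
  by (cases u; cases v; simp add: algebra_simps)+

text \<open>Expansion of the triple product: it is the combination of \<open>u\<close> and
  \<open>v\<close> with coefficients \<open>dot3 p v\<close> and \<open>- dot3 p u\<close>.\<close>

lemma cross_prod_cross_prod:
  assumes "dot3 p u = 0" "dot3 p v = 0"
  shows "cross_prod p (cross_prod u v) = (0, 0, 0)"
proof -
  obtain a b c x y z d e f where t: "u = (a, b, c)" "v = (x, y, z)" "p = (d, e, f)"
    by (cases u; cases v; cases p)
  have u: "d * a + e * b + f * c = 0" and v: "d * x + e * y + f * z = 0"
    using assms by (auto simp: t)
  have "e * (a * y - b * x) - f * (c * x - a * z)
      = a * (d * x + e * y + f * z) - x * (d * a + e * b + f * c)"
    "f * (b * z - c * y) - d * (a * y - b * x)
      = b * (d * x + e * y + f * z) - y * (d * a + e * b + f * c)"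
    "d * (c * x - a * z) - e * (b * z - c * y)
      = c * (d * x + e * y + f * z) - z * (d * a + e * b + f * c)"
    by (simp_all add: algebra_simps)
  then show ?thesis unfolding t cross_prod.simps u v by simp
qed

lemma pg2_polar_plane: "polar_plane (pg2 :: ('a::{field,finite} \<times> 'a \<times> 'a) set) (\<lambda>u x. dot3 u x = 0) CARD('a)"
proof
  show "finite (pg2 :: ('a \<times> 'a \<times> 'a) set)" by (rule finite_subset[OF subset_UNIV]) simp
  show "dot3 x y = 0 \<longleftrightarrow> dot3 y x = 0" for x y :: "'a \<times> 'a \<times> 'a" by (simp add: dot3_commute)
next
  fix x y :: "'a \<times> 'a \<times> 'a"
  assume xy: "x \<in> pg2" "y \<in> pg2" "x \<noteq> y"
  let ?w = "cross_prod x y"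
  have w: "?w \<noteq> (0, 0, 0)" using xy cross_prod_eq_0_imp_eq by blast
  show "\<exists>!z. z \<in> pg2 \<and> dot3 z x = 0 \<and> dot3 z y = 0"
  proof (rule ex1I[of _ "normalize3 ?w"])
    show "normalize3 ?w \<in> pg2 \<and> dot3 (normalize3 ?w) x = 0 \<and> dot3 (normalize3 ?w) y = 0"
      using normalize3_in_pg2 dot3_normalize3[OF w] dot3_cross_prod dot3_commute by metis
    show "z = normalize3 ?w" if "z \<in> pg2 \<and> dot3 z x = 0 \<and> dot3 z y = 0" for z
      using that cross_prod_cross_prod w by (blast intro: eq_normalize3_of_cross_prod_zero)
  qed
next
  fix u :: "'a \<times> 'a \<times> 'a"
  assume u: "u \<in> pg2"
  obtain a b c where abc: "u = (a, b, c)" by (cases u)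
  have card_ins: "card (insert e (range f)) = CARD('a) + 1"
    if "e \<notin> range f" "inj f" for e :: "'a \<times> 'a \<times> 'a" and f :: "'a \<Rightarrow> 'a \<times> 'a \<times> 'a"
    using that by (simp add: card_image)
  show "card {x \<in> pg2. dot3 u x = 0} = CARD('a) + 1"
  proof (cases "c = 0")
    case False
    have eq: "a + b * y + c * z = 0 \<longleftrightarrow> z = - (a + b * y) / c" for a y z
      using False add_eq_0_iff[of "a + b * y" "c * z"] by (simp add: nonzero_eq_divide_eq mult.commute)
    have "{x \<in> pg2. dot3 u x = 0} = insert (0, 1, - (0 + b * 1) / c) (range (\<lambda>y. (1, y, - (a + b * y) / c)))"
      (is "?A = ?B")
    proof
      show "?A \<subseteq> ?B"
      proof
        fix x assume x: "x \<in> ?A"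
        then have "x \<in> pg2" by simp
        then show "x \<in> ?B"
          using x eq[of a] eq[of 0 1] False by (cases rule: pg2_cases) (auto simp: abc)
      qed
      show "?B \<subseteq> ?A" using False by (auto simp: abc)
    qed
    then show ?thesis by (simp only:) (rule card_ins, auto simp: inj_def)
  next
    case c: True
    show ?thesis
    proof (cases "b = 0")
      case False
      have eq: "a + b * y = 0 \<longleftrightarrow> y = - a / b" for y
        using False add_eq_0_iff[of a "b * y"] by (simp only: nonzero_eq_divide_eq mult.commute[of b] simp_thms)
      have "{x \<in> pg2. dot3 u x = 0} = insert (0, 0, 1) (range (\<lambda>z. (1, - a / b, z)))"
        (is "?A = ?B")
      proof
        show "?A \<subseteq> ?B"
        proof
          fix x assume x: "x \<in> ?A"
          then have "x \<in> pg2" by simp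
          then show "x \<in> ?B"
            using x eq False by (cases rule: pg2_cases) (auto simp: abc c)
        qed
        show "?B \<subseteq> ?A" using False by (auto simp: abc c)
      qed
      then show ?thesis by (simp only:) (rule card_ins, auto simp: inj_def)
    next
      case b: True
      have a: "a \<noteq> 0" using pg2_nonzero[OF u] by (auto simp: abc b c)
      have "{x \<in> pg2. dot3 u x = 0} = insert (0, 0, 1) (range (\<lambda>z. (0, 1, z)))"
        using a by (auto simp: abc b c elim: pg2_cases)
      then show ?thesis by (simp only:) (rule card_ins, auto simp: inj_def)
    qed
  qed
qed

text \<open>Since \<open>m\<close> divides the field order, it is a power of the characteristic,
  which is odd by \<open>pow\<close>. An external line serves as line at infinity and makes the arc
  affine.\<close>

lemma pg2_no_maximal_arc:
  fixes K :: "('a::{field,finite} \<times> 'a \<times> 'a) set" and m :: nat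
  assumes arc: "polar_plane.maximal_arc pg2 (\<lambda>u x. dot3 u x = 0) CARD('a) m K"
    and m: "1 < m" "m < CARD('a)"
    and pow: "\<not> ((\<exists>i. m = 2 ^ i) \<and> (\<exists>j. CARD('a) = 2 ^ j))"
  shows False
proof -
  interpret polar_plane "pg2 :: ('a \<times> 'a \<times> 'a) set" "\<lambda>u x. dot3 u x = 0" "CARD('a)"
    by (rule pg2_polar_plane)
  have ne: "(pg2 :: ('a \<times> 'a \<times> 'a) set) \<noteq> {}" by (auto simp: pg2_def)
  have K: "K \<subseteq> pg2" "card K = (m - 1) * (CARD('a) + 1) + 1"
    and L: "\<And>u. u \<in> pg2 \<Longrightarrow> card (K \<inter> line u) \<in> {0, m}"
    using arc by (auto simp: maximal_arc_def)
  obtain h where h: "CARD('a) = CHAR('a) ^ h" using finite_field_card_eq_CHAR_power by blast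
  have "m dvd CHAR('a) ^ h" using maximal_arc_dvd_and_external_line(1)[OF arc m ne] h by simp
  then obtain e where e: "m = CHAR('a) ^ e"
    using prime_CHAR_finite_field divides_primepow_nat by blast
  have "CHAR('a) \<noteq> 2" using pow h e by metis
  then have char: "2 < CHAR('a)"
    using prime_ge_2_nat[OF prime_CHAR_finite_field[where 'a = 'a]] by simp
  obtain u where u: "u \<in> pg2" "K \<inter> line u = {}"
    using maximal_arc_dvd_and_external_line(2)[OF arc m ne] by blast
  obtain a b c where abc: "u = (a, b, c)" by (cases u)
  \<comment> \<open>Two coordinate forms complete \<open>u\<close> to a basis of the linear forms,
    the omitted coordinate having nonzero coefficient in \<open>u\<close>. The second clause
    homogenizes an affine line to a nonzero form.\<close>
  have "\<exists>f g. (\<forall>p. dot3 f p = 0 \<longrightarrow> dot3 g p = 0 \<longrightarrow> dot3 u p = 0 \<longrightarrow> p = (0, 0, 0)) \<and>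
      (\<forall>\<alpha> \<beta> \<gamma>. \<alpha> \<noteq> 0 \<or> \<beta> \<noteq> 0 \<longrightarrow>
        (\<exists>w. w \<noteq> (0, 0, 0) \<and> (\<forall>p. dot3 w p = \<alpha> * dot3 f p + \<beta> * dot3 g p - \<gamma> * dot3 u p)))"
  proof (cases "c = 0")
    case False
    show ?thesis
    proof (rule exI[of _ "(1, 0, 0)"], rule exI[of _ "(0, 1, 0)"], intro conjI allI impI)
      fix \<alpha> \<beta> \<gamma> :: 'a assume ab: "\<alpha> \<noteq> 0 \<or> \<beta> \<noteq> 0"
      let ?w = "(\<alpha> - \<gamma> * a, \<beta> - \<gamma> * b, - \<gamma> * c)"
      show "\<exists>w. w \<noteq> (0, 0, 0) \<and>
          (\<forall>p. dot3 w p = \<alpha> * dot3 (1, 0, 0) p + \<beta> * dot3 (0, 1, 0) p - \<gamma> * dot3 u p)"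
        using False ab by (intro exI[of _ ?w]) (auto simp: abc algebra_simps)
    qed (use False in \<open>auto simp: abc\<close>)
  next
    case c: True
    show ?thesis
    proof (cases "b = 0")
      case False
      show ?thesis
      proof (rule exI[of _ "(1, 0, 0)"], rule exI[of _ "(0, 0, 1)"], intro conjI allI impI)
        fix \<alpha> \<beta> \<gamma> :: 'a assume ab: "\<alpha> \<noteq> 0 \<or> \<beta> \<noteq> 0"
        let ?w = "(\<alpha> - \<gamma> * a, - \<gamma> * b, \<beta>)"
        show "\<exists>w. w \<noteq> (0, 0, 0) \<and>
            (\<forall>p. dot3 w p = \<alpha> * dot3 (1, 0, 0) p + \<beta> * dot3 (0, 0, 1) p - \<gamma> * dot3 u p)"
          using False ab by (intro exI[of _ ?w]) (auto simp: abc c algebra_simps)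
      qed (use False in \<open>auto simp: abc c\<close>)
    next
      case b: True
      have a: "a \<noteq> 0" using pg2_nonzero[OF u(1)] by (auto simp: abc b c)
      show ?thesis
      proof (rule exI[of _ "(0, 1, 0)"], rule exI[of _ "(0, 0, 1)"], intro conjI allI impI)
        fix \<alpha> \<beta> \<gamma> :: 'a assume ab: "\<alpha> \<noteq> 0 \<or> \<beta> \<noteq> 0"
        let ?w = "(- \<gamma> * a, \<alpha>, \<beta>)"
        show "\<exists>w. w \<noteq> (0, 0, 0) \<and>
            (\<forall>p. dot3 w p = \<alpha> * dot3 (0, 1, 0) p + \<beta> * dot3 (0, 0, 1) p - \<gamma> * dot3 u p)"
          using a ab by (intro exI[of _ ?w]) (auto simp: abc b c algebra_simps)
      qed (use a in \<open>auto simp: abc b c\<close>)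
    qed
  qed
  then obtain f g where fg: "\<And>p. dot3 f p = 0 \<Longrightarrow> dot3 g p = 0 \<Longrightarrow> dot3 u p = 0 \<Longrightarrow> p = (0, 0, 0)"
    and comb: "\<And>\<alpha> \<beta> \<gamma>. \<alpha> \<noteq> 0 \<or> \<beta> \<noteq> 0 \<Longrightarrow>
        \<exists>w. w \<noteq> (0, 0, 0) \<and> (\<forall>p. dot3 w p = \<alpha> * dot3 f p + \<beta> * dot3 g p - \<gamma> * dot3 u p)"
    by blast
  have ext: "dot3 u p \<noteq> 0" if "p \<in> K" for p using u that K(1) by (auto simp: line_def)
  define \<psi> where "\<psi> = (\<lambda>p. (dot3 f p / dot3 u p, dot3 g p / dot3 u p))"
  have inj: "inj_on \<psi> K"
  proof (rule inj_onI)
    fix p r assume pr: "p \<in> K" "r \<in> K" "\<psi> p = \<psi> r"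
    obtain x y z where p: "p = (x, y, z)" by (cases p)
    obtain x' y' z' where r: "r = (x', y', z')" by (cases r)
    let ?s = "dot3 u p" and ?t = "dot3 u r"
    have st: "?s \<noteq> 0" "?t \<noteq> 0" using ext pr by auto
    \<comment> \<open>Cross-multiplied difference of \<open>p\<close> and \<open>r\<close>; all
      three forms \<open>f\<close>, \<open>g\<close>, \<open>u\<close> vanish on it.\<close>
    let ?w = "(?t * x - ?s * x', ?t * y - ?s * y', ?t * z - ?s * z')"
    have w: "dot3 k ?w = ?t * dot3 k p - ?s * dot3 k r" for k
      by (cases k) (simp add: p r algebra_simps)
    have "dot3 f p / ?s = dot3 f r / ?t" "dot3 g p / ?s = dot3 g r / ?t" using pr(3) by (auto simp: \<psi>_def)
    then have "?t * dot3 f p = ?s * dot3 f r" "?t * dot3 g p = ?s * dot3 g r"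
      using st by (simp_all add: frac_eq_eq mult.commute)
    then have "?w = (0, 0, 0)" using w by (intro fg) (simp_all add: mult.commute)
    then have e: "?t * x = ?s * x'" "?t * y = ?s * y'" "?t * z = ?s * z'" by simp_all
    have "?t * (y * z' - z * y') = (?t * y) * z' - (?t * z) * y'"
      "?t * (z * x' - x * z') = (?t * z) * x' - (?t * x) * z'"
      "?t * (x * y' - y * x') = (?t * x) * y' - (?t * y) * x'" by (simp_all add: algebra_simps)
    then have "?t * (y * z' - z * y') = 0" "?t * (z * x' - x * z') = 0" "?t * (x * y' - y * x') = 0"
      unfolding e by (simp_all add: algebra_simps)
    then have "cross_prod p r = (0, 0, 0)" using st(2) unfolding p r by simp
    then show "p = r" using pr K(1) cross_prod_eq_0_imp_eq by blast
  qed
  show False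
  proof (rule no_odd_maximal_arc_affine[OF char e m])
    show "card (\<psi> ` K) = (m - 1) * (CARD('a) + 1) + 1" using card_image[OF inj] K(2) by simp
    fix \<alpha> \<beta> \<gamma> :: 'a assume "\<alpha> \<noteq> 0 \<or> \<beta> \<noteq> 0"
    then obtain w where w: "w \<noteq> (0, 0, 0)"
      "\<And>p. dot3 w p = \<alpha> * dot3 f p + \<beta> * dot3 g p - \<gamma> * dot3 u p" using comb by blast
    have "\<alpha> * fst (\<psi> p) + \<beta> * snd (\<psi> p) = \<gamma> \<longleftrightarrow> p \<in> line (normalize3 w)" if p: "p \<in> K" for p
    proof -
      have "\<alpha> * fst (\<psi> p) + \<beta> * snd (\<psi> p) = (\<alpha> * dot3 f p + \<beta> * dot3 g p) / dot3 u p"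
        by (simp add: \<psi>_def add_divide_distrib)
      then have "\<alpha> * fst (\<psi> p) + \<beta> * snd (\<psi> p) = \<gamma> \<longleftrightarrow> dot3 w p = 0"
        using ext[OF p] by (simp add: w(2) nonzero_divide_eq_eq)
      then show ?thesis
        using p K(1) dot3_normalize3[OF w(1), of p] by (auto simp: line_def dot3_commute)
    qed
    then have "{r \<in> \<psi> ` K. \<alpha> * fst r + \<beta> * snd r = \<gamma>} = \<psi> ` (K \<inter> line (normalize3 w))" by blast
    then have "card {r \<in> \<psi> ` K. \<alpha> * fst r + \<beta> * snd r = \<gamma>} = card (K \<inter> line (normalize3 w))"
      using inj by (simp add: card_image inj_on_Int)
    then show "card {r \<in> \<psi> ` K. \<alpha> * fst r + \<beta> * snd r = \<gamma>} \<in> {0, m}"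
      using L[OF normalize3_in_pg2] by (simp only:)
  qed
qed

text \<open>The vectors may be zero or proportional. After normalization \<open>arc_inj\<close>
  excludes repetitions, and the resulting set, extended by a point where necessary, is a maximal arc
  of degree \<open>s + 1\<close>.\<close>

theorem no_large_plane_arc:
  fixes v :: "'i \<Rightarrow> 'a::{field,finite} \<times> 'a \<times> 'a" and s :: nat
  assumes I: "finite I" and s: "1 < s" "s + 1 < CARD('a)"
    and large: "s * (CARD('a) + 1) \<le> card I"
    and lines: "\<And>w. w \<noteq> (0, 0, 0) \<Longrightarrow> card {i \<in> I. dot3 w (v i) = 0} \<le> s + 1"
    and pow: "\<not> ((\<exists>i. s + 1 = 2 ^ i) \<and> (\<exists>j. CARD('a) = 2 ^ j))"
  shows False
proof -
  interpret polar_plane "pg2 :: ('a \<times> 'a \<times> 'a) set" "\<lambda>u x. dot3 u x = 0" "CARD('a)"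
    by (rule pg2_polar_plane)
  have "\<exists>j\<in>I. v j \<noteq> (0, 0, 0)"
  proof (rule ccontr)
    assume "\<not> ?thesis"
    then have "{i \<in> I. dot3 (1, 0, 0) (v i) = 0} = I" by auto
    then have "card I \<le> s + 1" using lines[of "(1, 0, 0)"] by simp
    then have "s * (CARD('a) + 1) \<le> s + 1" using large by linarith
    moreover have "s * 3 \<le> s * (CARD('a) + 1)" using s by (intro mult_le_mono) auto
    ultimately show False using s by linarith
  qed
  then obtain j where j: "j \<in> I" "v j \<noteq> (0, 0, 0)" by auto
  \<comment> \<open>Zero vectors lie on every line, so moving them to an existing point only lowers the line counts.\<close>
  define p where "p = (\<lambda>i. normalize3 (if v i = (0, 0, 0) then v j else v i))"
  have p: "p i \<in> pg2" for i by (simp add: p_def normalize3_in_pg2)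
  have on_line: "{i \<in> I. p i \<in> line u} \<subseteq> {i \<in> I. dot3 u (v i) = 0}" if "u \<in> pg2" for u
  proof
    fix i assume i: "i \<in> {i \<in> I. p i \<in> line u}"
    show "i \<in> {i \<in> I. dot3 u (v i) = 0}"
    proof (cases "v i = (0, 0, 0)")
      case True
      then show ?thesis using i by (cases u) auto
    next
      case False
      then show ?thesis using i dot3_normalize3[OF False] by (auto simp: p_def line_def)
    qed
  qed
  have le: "card {i \<in> I. p i \<in> line u} \<le> s + 1" if "u \<in> pg2" for u
    using card_mono[OF _ on_line[OF that]] I lines[OF pg2_nonzero[OF that]] by fastforce
  have inj: "inj_on p I"
    by (rule arc_inj[where m = "s + 1"]) (use I p le large s in auto)
  have "\<exists>K. maximal_arc (s + 1) K"
  proof (rule large_arc_gives_maximal_arc)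
    show "p ` I \<subseteq> pg2" using p by auto
    show "card (p ` I \<inter> line u) \<le> s + 1" if "u \<in> pg2" for u
    proof -
      have "p ` I \<inter> line u = p ` {i \<in> I. p i \<in> line u}" by auto
      then show ?thesis using le[OF that] card_image_le[of "{i \<in> I. p i \<in> line u}" p] I by simp
    qed
    show "(s + 1 - 1) * (CARD('a) + 1) \<le> card (p ` I)" using large card_image[OF inj] by simp
  qed (use s in auto)
  then obtain K where "maximal_arc (s + 1) K" ..
  then show False using s pow by (intro pg2_no_maximal_arc[of "s + 1" K]) auto
qed

section \<open>Linear codes\<close>

unbundle no Formal_Power_Series.fps_syntax

section \<open>Linear equations and shortened codes\<close>

lemma subspace_dot_zero:
  assumes "vec.subspace S"
  shows "vec.subspace {x \<in> S. (\<Sum>i\<in>UNIV. b $ i * x $ i) = (0 :: 'a::field)}"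
proof -
  have "(\<Sum>i\<in>UNIV. b $ i * (c * x $ i)) = c * (\<Sum>i\<in>UNIV. b $ i * x $ i)" for c :: 'a and x
    by (simp add: sum_distrib_left ac_simps)
  then show ?thesis
    using assms by (auto simp: vec.subspace_def distrib_left sum.distrib)
qed

lemma dim_dot_zero_ge:
  fixes S :: "('a::field ^ 'n) set"
  assumes S: "vec.subspace S"
  shows "vec.dim S \<le> vec.dim {x \<in> S. (\<Sum>i\<in>UNIV. b $ i * x $ i) = 0} + 1"
proof -
  define \<phi> where "\<phi> = (\<lambda>x :: 'a ^ 'n. \<Sum>i\<in>UNIV. b $ i * x $ i)"
  let ?T = "{x \<in> S. \<phi> x = 0}"
  have \<phi>_lin: "\<phi> (x - c *s y) = \<phi> x - c * \<phi> y" for x y c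
    by (simp add: \<phi>_def right_diff_distrib sum_subtractf sum_distrib_left ac_simps)
  have "vec.dim S \<le> vec.dim ?T + 1"
  proof (cases "S \<subseteq> ?T")
    case True
    then show ?thesis using vec.dim_subset[OF True] by simp
  next
    case False
    then obtain z where z: "z \<in> S" "\<phi> z \<noteq> 0" by auto
    have "S \<subseteq> vec.span (insert z ?T)"
    proof
      fix x assume x: "x \<in> S"
      let ?c = "\<phi> x / \<phi> z"
      have "x - ?c *s z \<in> S" using S x z by (intro vec.subspace_diff vec.subspace_scale)
      then have "x - ?c *s z \<in> ?T" using z by (simp add: \<phi>_lin)
      then have "x - ?c *s z \<in> vec.span (insert z ?T)" by (intro vec.span_base) simp
      moreover have "?c *s z \<in> vec.span (insert z ?T)"
        by (intro vec.span_scale vec.span_base) simp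
      ultimately have "(x - ?c *s z) + ?c *s z \<in> vec.span (insert z ?T)" by (rule vec.span_add)
      then show "x \<in> vec.span (insert z ?T)" by simp
    qed
    then have "vec.dim S \<le> vec.dim (insert z ?T)" by (rule vec.dim_mono)
    also have "\<dots> \<le> vec.dim ?T + 1" by (simp add: vec.dim_insert)
    finally show ?thesis .
  qed
  then show ?thesis by (simp add: \<phi>_def)
qed

text \<open>The coordinates in \<open>Z\<close> are kept as zeros rather than deleted, so the vector
  type does not change.\<close>

definition shortened :: "('a::field ^ 'n) set \<Rightarrow> 'n set \<Rightarrow> ('a ^ 'n) set" where
  "shortened C Z = {c \<in> C. \<forall>i\<in>Z. c $ i = 0}"

lemma subspace_shortened: "vec.subspace C \<Longrightarrow> vec.subspace (shortened C Z)"
  by (auto simp: shortened_def vec.subspace_def)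

lemma sum_axis_mult: "(\<Sum>j\<in>UNIV. axis i 1 $ j * x $ j) = (x $ i :: 'a::field)"
  by (simp add: axis_def if_distrib[of "\<lambda>c. c * _"] cong: if_cong)

lemma dim_shortened_ge:
  fixes C :: "('a::field ^ 'n) set"
  assumes C: "vec.subspace C"
  shows "vec.dim C \<le> vec.dim (shortened C Z) + card Z"
proof -
  have "finite Z" by (rule finite_subset[OF subset_UNIV]) simp
  then show ?thesis
  proof (induction Z rule: finite_induct)
    case empty
    then show ?case by (simp add: shortened_def)
  next
    case (insert i Z)
    have "{x \<in> shortened C Z. (\<Sum>j\<in>UNIV. axis i 1 $ j * x $ j) = 0} = shortened C (insert i Z)"
      unfolding sum_axis_mult by (auto simp: shortened_def)
    from dim_dot_zero_ge[OF subspace_shortened[OF C, of Z], of "axis i 1", unfolded this]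
    show ?case using insert by simp
  qed
qed

text \<open>The dual word \<open>y\<close> expresses one coordinate in \<open>Z\<close> through the
  others, so the zero condition there is implied and one dimension is saved.\<close>

lemma dim_shortened_dependent:
  fixes C :: "('a::field ^ 'n) set"
  assumes C: "vec.subspace C" and y: "y \<in> dual_code C" "y \<noteq> 0" and Z: "{i. y $ i \<noteq> 0} \<subseteq> Z"
  shows "vec.dim C + 1 \<le> vec.dim (shortened C Z) + card Z"
proof -
  obtain i where i: "y $ i \<noteq> 0" using y(2) by (auto simp: vec_eq_iff)
  have iZ: "i \<in> Z" using i Z by auto
  have "shortened C Z = shortened C (Z - {i})"
  proof
    show "shortened C (Z - {i}) \<subseteq> shortened C Z"
    proof
      fix c assume c: "c \<in> shortened C (Z - {i})"
      then have "0 = (\<Sum>j\<in>UNIV. c $ j * y $ j)" using y(1) by (simp add: dual_code_def shortened_def)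
      also have "\<dots> = c $ i * y $ i + (\<Sum>j\<in>UNIV - {i}. c $ j * y $ j)"
        by (rule sum.remove) auto
      also have "(\<Sum>j\<in>UNIV - {i}. c $ j * y $ j) = 0"
        using c Z by (intro sum.neutral) (auto simp: shortened_def)
      finally have "c $ i = 0" using i by simp
      then show "c \<in> shortened C Z" using c by (auto simp: shortened_def)
    qed
  qed (auto simp: shortened_def)
  moreover have "finite Z" by (rule finite_subset[OF subset_UNIV]) simp
  then have "card Z = card (Z - {i}) + 1" using iZ card_Suc_Diff1[of Z i] by simp
  ultimately show ?thesis using dim_shortened_ge[OF C, of "Z - {i}"] by simp
qed

lemma obtain_independent_subset:
  fixes S :: "('a::field ^ 'n) set"
  assumes "j \<le> vec.dim S"
  obtains B where "B \<subseteq> S" "vec.independent B" "finite B" "card B = j"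
proof -
  obtain B where B: "B \<subseteq> S" "vec.independent B" "S \<subseteq> vec.span B" "card B = vec.dim S"
    by (rule vec.basis_exists)
  have "j \<le> card B" using B(4) assms by simp
  then obtain B' where B': "B' \<subseteq> B" "card B' = j" "finite B'"
    by (rule obtain_subset_with_card_n)
  show ?thesis
    by (rule that[OF order_trans[OF B'(1) B(1)] vec.independent_mono[OF B(2) B'(1)] B'(3,2)])
qed

lemma obtain_independent_pair:
  fixes S :: "('a::field ^ 'n) set"
  assumes "2 \<le> vec.dim S"
  obtains x y where "x \<in> S" "y \<in> S" "\<And>a b. a *s x + b *s y = 0 \<Longrightarrow> a = 0 \<and> b = 0"
proof -
  obtain B where B: "B \<subseteq> S" "vec.independent B" "card B = 2"
    using obtain_independent_subset[OF assms] .
  obtain x y where xy: "B = {x, y}" "x \<noteq> y" using B(3) by (auto simp: card_2_iff)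
  have "a = 0 \<and> b = 0" if "a *s x + b *s y = 0" for a b
  proof -
    let ?u = "\<lambda>v. if v = x then a else b"
    have "(\<Sum>v\<in>B. ?u v *s v) = 0" using xy that by simp
    then have "\<And>v. v \<in> B \<Longrightarrow> ?u v = 0"
      using vec.independentD[OF B(2), of B ?u] xy by blast
    from this[of x] this[of y] show ?thesis using xy by simp
  qed
  then show ?thesis using that xy B(1) by blast
qed

lemma obtain_independent_triple:
  fixes S :: "('a::field ^ 'n) set"
  assumes "3 \<le> vec.dim S"
  obtains x y z where "x \<in> S" "y \<in> S" "z \<in> S"
    "\<And>a b c. a *s x + b *s y + c *s z = 0 \<Longrightarrow> a = 0 \<and> b = 0 \<and> c = 0"
proof -
  obtain B where B: "B \<subseteq> S" "vec.independent B" "card B = 3"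
    using obtain_independent_subset[OF assms] .
  obtain x y z where xyz: "B = {x, y, z}" "x \<noteq> y" "y \<noteq> z" "x \<noteq> z" using B(3) by (auto simp: card_3_iff)
  have "a = 0 \<and> b = 0 \<and> c = 0" if "a *s x + b *s y + c *s z = 0" for a b c
  proof -
    let ?u = "\<lambda>v. if v = x then a else if v = y then b else c"
    have "(\<Sum>v\<in>B. ?u v *s v) = 0" using xyz that by (simp add: add.assoc)
    then have "\<And>v. v \<in> B \<Longrightarrow> ?u v = 0"
      using vec.independentD[OF B(2), of B ?u] xyz by blast
    from this[of x] this[of y] this[of z] show ?thesis using xyz by simp
  qed
  then show ?thesis using that xyz B(1) by blast
qed

lemma card_Compl_finite: "card (- A) = CARD('n) - card A" for A :: "'n::finite set"
  by (simp add: Compl_eq_Diff_UNIV card_Diff_subset)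

lemma obtain_superset_with_card:
  fixes A :: "'n::finite set"
  assumes "card A \<le> k" "k \<le> CARD('n)"
  obtains Z where "A \<subseteq> Z" "card Z = k"
proof -
  have "k - card A \<le> card (- A)" using assms by (simp add: card_Compl_finite)
  then obtain T where T: "T \<subseteq> - A" "card T = k - card A" by (metis obtain_subset_with_card_n)
  have "card (A \<union> T) = k" using T assms by (subst card_Un_disjoint) auto
  then show ?thesis using that[of "A \<union> T"] by simp
qed

lemma card_zeros_outside:
  assumes "c \<in> shortened C Z" "card {i. c $ i = 0} \<le> card Z + t"
  shows "card {i \<in> - Z. c $ i = 0} \<le> t"
proof -
  have "{i. c $ i = 0} = Z \<union> {i \<in> - Z. c $ i = 0}" using assms(1) by (auto simp: shortened_def)
  moreover have "card (Z \<union> {i \<in> - Z. c $ i = 0}) = card Z + card {i \<in> - Z. c $ i = 0}"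
    by (intro card_Un_disjoint) auto
  ultimately show ?thesis using assms(2) by simp
qed

text \<open>
  Shortening at a dependent set of \<open>k - 1\<close> columns leaves a pencil of \<open>q + 1\<close> words up to scalars,
  whose zeros cover the remaining coordinates.
\<close>

lemma dual_weight_ge_dim:
  fixes C :: "('a::{field,finite} ^ 'n) set"
  assumes C: "vec.subspace C" "0 < vec.dim C"
    and zeros: "\<And>c. c \<in> C \<Longrightarrow> c \<noteq> 0 \<Longrightarrow> card {i. c $ i = 0} \<le> vec.dim C - 1 + t"
    and n: "t * (CARD('a) + 1) + vec.dim C \<le> CARD('n)"
    and y: "y \<in> dual_code C" "y \<noteq> 0"
  shows "vec.dim C \<le> card {i. y $ i \<noteq> 0}"
proof (rule ccontr)
  assume "\<not> ?thesis"
  then have "card {i. y $ i \<noteq> 0} \<le> vec.dim C - 1" "vec.dim C - 1 \<le> CARD('n)" using n by auto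
  then obtain Z where Z: "{i. y $ i \<noteq> 0} \<subseteq> Z" "card Z = vec.dim C - 1"
    by (rule obtain_superset_with_card)
  have sub: "vec.subspace (shortened C Z)" by (rule subspace_shortened[OF C(1)])
  have "2 \<le> vec.dim (shortened C Z)"
    using dim_shortened_dependent[OF C(1) y Z(1)] Z(2) C(2) by linarith
  then obtain u v where uv: "u \<in> shortened C Z" "v \<in> shortened C Z"
    "\<And>a b. a *s u + b *s v = 0 \<Longrightarrow> a = 0 \<and> b = 0"
    by (rule obtain_independent_pair) blast
  \<comment> \<open>Representatives of the \<open>q + 1\<close> points of the projective line, one
    for each word of the pencil up to scalars.\<close>
  define N where "N = insert (0, 1) (range (\<lambda>c :: 'a. (1 :: 'a, c)))"
  define zs where "zs = (\<lambda>(a, b). {i \<in> - Z. a * u $ i + b * v $ i = 0})"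
  have le: "card (zs p) \<le> t" if "p \<in> N" for p
  proof -
    obtain a b where p: "p = (a, b)" by (cases p)
    have "a \<noteq> 0 \<or> b \<noteq> 0" using that p by (auto simp: N_def)
    then have nz: "a *s u + b *s v \<noteq> 0" using uv(3) by blast
    have mem: "a *s u + b *s v \<in> shortened C Z"
      using sub uv by (intro vec.subspace_add vec.subspace_scale)
    then have "a *s u + b *s v \<in> C" by (simp add: shortened_def)
    then have "card {i. (a *s u + b *s v) $ i = 0} \<le> card Z + t"
      unfolding Z(2) by (rule zeros[OF _ nz])
    from card_zeros_outside[OF mem this] show ?thesis by (simp add: zs_def p)
  qed
  have cover: "- Z \<subseteq> (\<Union>p\<in>N. zs p)"
  proof
    fix i assume i: "i \<in> - Z"
    show "i \<in> (\<Union>p\<in>N. zs p)"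
    proof (cases "v $ i = 0")
      case True
      then have "i \<in> zs (0, 1)" using i by (simp add: zs_def)
      then show ?thesis by (auto simp: N_def)
    next
      case False
      then have "i \<in> zs (1, - u $ i / v $ i)" using i by (simp add: zs_def)
      then show ?thesis by (auto simp: N_def)
    qed
  qed
  have "finite (\<Union>p\<in>N. zs p)" by (rule finite_subset[OF subset_UNIV]) simp
  then have "card (- Z) \<le> card (\<Union>p\<in>N. zs p)" using cover by (rule card_mono)
  also have "\<dots> \<le> (\<Sum>p\<in>N. card (zs p))" by (rule card_UN_le) (simp add: N_def)
  also have "\<dots> \<le> (\<Sum>p\<in>N. t)" using le by (rule sum_mono)
  also have "\<dots> \<le> (CARD('a) + 1) * t"
  proof -
    have "card N \<le> CARD('a) + 1"
      unfolding N_def by (rule order_trans[OF card_insert_le_m1]) (auto intro: card_image_le)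
    then show ?thesis unfolding sum_constant of_nat_id by (rule mult_le_mono1)
  qed
  finally have "CARD('n) - (vec.dim C - 1) \<le> (CARD('a) + 1) * t" using Z(2) by (simp add: card_Compl_finite)
  then show False using n C(2) unfolding mult.commute[of t] by linarith
qed

text \<open>The coordinates outside \<open>Z\<close> become vectors
  \<open>(u $ i, v $ i, w $ i)\<close>, and zeros of a combination of the three words become points
  on a line. A word has at most \<open>s + 1\<close> zeros beyond the \<open>k - 2\<close> in
  \<open>Z\<close>.\<close>

lemma dual_weight_ge_dim_minus_1:
  fixes C :: "('a::{field,finite} ^ 'n) set"
  assumes C: "vec.subspace C" "1 < vec.dim C"
    and zeros: "\<And>c. c \<in> C \<Longrightarrow> c \<noteq> 0 \<Longrightarrow> card {i. c $ i = 0} \<le> vec.dim C - 1 + s"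
    and n: "s * (CARD('a) + 1) + vec.dim C \<le> CARD('n) + 2"
    and s: "1 < s" "s + 1 < CARD('a)"
    and pow: "\<not> ((\<exists>i. s + 1 = 2 ^ i) \<and> (\<exists>j. CARD('a) = 2 ^ j))"
    and y: "y \<in> dual_code C" "y \<noteq> 0"
  shows "vec.dim C - 1 \<le> card {i. y $ i \<noteq> 0}"
proof (rule ccontr)
  assume "\<not> ?thesis"
  moreover have "2 \<le> s * (CARD('a) + 1)" using s by (simp add: algebra_simps)
  ultimately have "card {i. y $ i \<noteq> 0} \<le> vec.dim C - 2" "vec.dim C - 2 \<le> CARD('n)"
    using n by linarith+
  then obtain Z where Z: "{i. y $ i \<noteq> 0} \<subseteq> Z" "card Z = vec.dim C - 2"
    by (rule obtain_superset_with_card)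
  have sub: "vec.subspace (shortened C Z)" by (rule subspace_shortened[OF C(1)])
  have "3 \<le> vec.dim (shortened C Z)"
    using dim_shortened_dependent[OF C(1) y Z(1)] Z(2) C(2) by linarith
  then obtain u v w where uvw: "u \<in> shortened C Z" "v \<in> shortened C Z" "w \<in> shortened C Z"
    "\<And>a b c. a *s u + b *s v + c *s w = 0 \<Longrightarrow> a = 0 \<and> b = 0 \<and> c = 0"
    by (rule obtain_independent_triple) blast
  show False
  proof (rule no_large_plane_arc[OF _ s _ _ pow])
    show "finite (- Z)" by (rule finite_subset[OF subset_UNIV]) simp
    show "s * (CARD('a) + 1) \<le> card (- Z)" using Z(2) n C(2) by (simp add: card_Compl_finite)
    fix p :: "'a \<times> 'a \<times> 'a" assume "p \<noteq> (0, 0, 0)"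
    moreover obtain a b c where p: "p = (a, b, c)" by (cases p)
    ultimately have nz: "a *s u + b *s v + c *s w \<noteq> 0" using uvw(4) by blast
    have mem: "a *s u + b *s v + c *s w \<in> shortened C Z"
      using sub uvw by (intro vec.subspace_add vec.subspace_scale)
    then have "a *s u + b *s v + c *s w \<in> C" by (simp add: shortened_def)
    from zeros[OF this nz]
    have "card {i. (a *s u + b *s v + c *s w) $ i = 0} \<le> card Z + (s + 1)"
      using Z(2) C(2) by linarith
    from card_zeros_outside[OF mem this]
    show "card {i \<in> - Z. dot3 p (u $ i, v $ i, w $ i) = 0} \<le> s + 1" by (simp add: p)
  qed
qed

section \<open>Dual codes and minimum distance\<close>

lemma subspace_dual_code:
  fixes C :: "('a::field ^ 'n) set"
  shows "vec.subspace (dual_code C)"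
proof -
  have "(\<Sum>i\<in>UNIV. x $ i * (c * y $ i)) = c * (\<Sum>i\<in>UNIV. x $ i * y $ i)" for c :: 'a and x y :: "'a ^ 'n"
    by (simp add: sum_distrib_left ac_simps)
  then show ?thesis by (auto simp: vec.subspace_def dual_code_def distrib_left sum.distrib)
qed

lemma dual_code_span: "dual_code (vec.span B) = dual_code B"
proof
  show "dual_code (vec.span B) \<subseteq> dual_code B" by (auto simp: dual_code_def vec.span_base)
  show "dual_code B \<subseteq> dual_code (vec.span B)"
  proof
    fix y assume y: "y \<in> dual_code B"
    have "B \<subseteq> {x \<in> UNIV. (\<Sum>i\<in>UNIV. y $ i * x $ i) = 0}"
      using y by (auto simp: dual_code_def mult.commute)
    then have "vec.span B \<subseteq> {x \<in> UNIV. (\<Sum>i\<in>UNIV. y $ i * x $ i) = 0}"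
      by (intro vec.span_minimal subspace_dot_zero) auto
    then show "y \<in> dual_code (vec.span B)" by (auto simp: dual_code_def mult.commute)
  qed
qed

text \<open>Each new vector \<open>b\<close> imposes one equation, lowering the dimension by at most
  1. It does lower it, because some functional vanishes on \<open>B\<close> but not on
  \<open>b\<close>.\<close>

lemma dim_dual_independent:
  fixes B :: "('a::field ^ 'n) set"
  assumes "finite B" "vec.independent B"
  shows "vec.dim (dual_code B) + card B = CARD('n)"
  using assms
proof (induction B rule: finite_induct)
  case empty
  have "dual_code ({} :: ('a ^ 'n) set) = UNIV" by (simp add: dual_code_def)
  then show ?case by (simp only: vec_dim_card card.empty add_0_right)
next
  case (insert b B)
  have indB: "vec.independent B" using insert.prems by (rule vec.independent_mono) auto
  have IH: "vec.dim (dual_code B) + card B = CARD('n)" using insert.IH indB by simp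
  have eq: "dual_code (insert b B) = {y \<in> dual_code B. (\<Sum>i\<in>UNIV. b $ i * y $ i) = 0}"
    by (auto simp: dual_code_def)
  have ge: "vec.dim (dual_code B) \<le> vec.dim (dual_code (insert b B)) + 1"
    unfolding eq by (rule dim_dot_zero_ge[OF subspace_dual_code])
  \<comment> \<open>The extension theorem is used for a map into the same space; coordinate
    \<open>j\<close> of that map is the required functional.\<close>
  obtain j :: 'n where True by simp
  obtain g where g: "Vector_Spaces.linear (*s) (*s) g"
    "\<forall>x\<in>insert b B. g x = (if x = b then axis j 1 else (0 :: 'a ^ 'n))"
    using vec.linear_independent_extend[OF insert.prems, of "\<lambda>x. if x = b then axis j 1 else 0"] by blast
  define y where "y = (\<chi> i. g (axis i 1) $ j)"
  have gy: "(\<Sum>i\<in>UNIV. x $ i * y $ i) = g x $ j" for x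
  proof -
    have "g x = g (\<Sum>i\<in>UNIV. x $ i *s axis i 1)" by (simp add: basis_expansion)
    also have "\<dots> = (\<Sum>i\<in>UNIV. x $ i *s g (axis i 1))"
      by (simp add: vec.linear_sum[OF g(1)] vec.linear_scale[OF g(1)])
    finally show ?thesis by (simp add: y_def)
  qed
  have "y \<in> dual_code B" using g(2) insert.hyps by (auto simp: dual_code_def gy)
  moreover have "y \<notin> dual_code (insert b B)" using g(2) by (auto simp: dual_code_def gy axis_def)
  ultimately have "dual_code (insert b B) \<subset> dual_code B" unfolding eq by auto
  then have "vec.dim (dual_code (insert b B)) < vec.dim (dual_code B)"
    by (intro vec.dim_psubset) (simp add: vec.span_eq_iff[THEN iffD2, OF subspace_dual_code])
  then show ?case using ge IH insert.hyps by simp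
qed

lemma dim_dual_code:
  fixes C :: "('a::field ^ 'n) set"
  assumes "vec.subspace C"
  shows "vec.dim (dual_code C) + vec.dim C = CARD('n)"
proof -
  obtain B where B: "B \<subseteq> C" "vec.independent B" "C \<subseteq> vec.span B" "card B = vec.dim C"
    by (rule vec.basis_exists)
  have "vec.span B = C" using B assms by (intro subset_antisym vec.span_minimal)
  then have "dual_code C = dual_code B" using dual_code_span[of B] by simp
  then show ?thesis
    using dim_dual_independent[of B] B vec.independent_bound_general[of B] vec.finiteI_independent by metis
qed

lemma subset_dual_dual: "C \<subseteq> dual_code (dual_code C)"
  by (auto simp: dual_code_def mult.commute)

lemma dual_dual_code:
  fixes C :: "('a::field ^ 'n) set"
  assumes "vec.subspace C"
  shows "dual_code (dual_code C) = C"
proof -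
  have "vec.dim (dual_code (dual_code C)) = vec.dim C"
    using dim_dual_code[OF assms] dim_dual_code[OF subspace_dual_code, of C] by linarith
  then show ?thesis
    using vec.subspace_dim_equal[OF assms subspace_dual_code subset_dual_dual] by simp
qed

text \<open>By linearity, distances are weights of differences. The word \<open>z\<close> makes the
  set of distances nonempty, so its minimum is attained.\<close>

lemma min_distance_properties:
  fixes C :: "('a::field ^ 'n) set"
  assumes C: "vec.subspace C" "z \<in> C" "z \<noteq> 0"
  shows "c \<in> C \<Longrightarrow> c \<noteq> 0 \<Longrightarrow> min_distance C \<le> card {i. c $ i \<noteq> 0}"
    and "\<exists>c\<in>C. c \<noteq> 0 \<and> card {i. c $ i \<noteq> 0} = min_distance C"
proof -
  let ?D = "{hamming_distance x y | x y. x \<in> C \<and> y \<in> C \<and> x \<noteq> y}"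
  have zero: "0 \<in> C" using C(1) by (rule vec.subspace_0)
  have D: "card {i. c $ i \<noteq> 0} \<in> ?D" if "c \<in> C" "c \<noteq> 0" for c
  proof -
    have "card {i. c $ i \<noteq> 0} = hamming_distance c 0" by (simp add: hamming_distance_def)
    then show ?thesis using that zero by blast
  qed
  have "?D \<subseteq> {..CARD('n)}" by (auto simp: hamming_distance_def intro: card_mono)
  then have fin: "finite ?D" by (rule finite_subset) simp
  show "min_distance C \<le> card {i. c $ i \<noteq> 0}" if "c \<in> C" "c \<noteq> 0"
    unfolding min_distance_def using fin D[OF that] by (rule Min_le)
  have "min_distance C \<in> ?D"
    unfolding min_distance_def using fin D[OF C(2,3)] by (intro Min_in) auto
  then obtain x y where xy: "x \<in> C" "y \<in> C" "x \<noteq> y" "min_distance C = hamming_distance x y" by blast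
  have "x - y \<in> C" "x - y \<noteq> 0" using C(1) xy vec.subspace_diff by auto
  moreover have "card {i. (x - y) $ i \<noteq> 0} = min_distance C" using xy by (simp add: hamming_distance_def)
  ultimately show "\<exists>c\<in>C. c \<noteq> 0 \<and> card {i. c $ i \<noteq> 0} = min_distance C" by blast
qed

lemma card_zeros: "card {i. c $ i = 0} + card {i. c $ i \<noteq> 0} = CARD('n)" for c :: "'a::zero ^ 'n"
  by (subst card_Un_disjoint[symmetric]) (auto intro: arg_cong[of _ _ card])

lemma ex_nonzero_of_dim: "0 < vec.dim C \<Longrightarrow> \<exists>z\<in>C. z \<noteq> (0 :: 'a::field ^ 'n)"
proof (rule ccontr)
  assume "0 < vec.dim C" "\<not> (\<exists>z\<in>C. z \<noteq> 0)"
  then have "C \<subseteq> {0}" by blast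
  then have "vec.dim C = 0" unfolding vec.dim_eq_0 .
  then show False using \<open>0 < vec.dim C\<close> by linarith
qed

theorem mainTheorem2:
  fixes C :: "('a::{field,finite} ^ 'n) set" and n k d q s :: nat
  assumes "q = CARD('a)"
    and "nkd_code n k d C"
    and "AsMDS s C"
    and "1 < s" and "int s < int q - 1"
    and "\<not> ((\<exists>a::nat. s + 1 = 2 ^ a) \<and> (\<exists>b::nat. q = 2 ^ b))"
    and "int k > (int s - 1) * (int q + 1) - 1"
    and "int n > int s * (int q + 1) + int k - 3"
  shows "AsMDS s (dual_code C) \<and> NsMDS s C"
proof -
  have C: "vec.subspace C" and n: "CARD('n) = n" and k: "vec.dim C = k" "0 < k"
    and d: "min_distance C = d"
    using assms(2) by (auto simp: nkd_code_def)
  \<comment> \<open>The parameters quantified in \<open>AsMDS\<close> are determined by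
    \<open>C\<close>, hence are the given ones.\<close>
  have "int n - int k + 1 - int d = int s"
    using assms(3) n k d by (auto simp: AsMDS_def nkd_code_def)
  then have dks: "d + k + s = n + 1" by linarith
  have s: "1 < s" "s + 1 < CARD('a)" using assms by linarith+
  have "int (s - 1) = int s - 1" using assms(4) by simp
  then have "int ((s - 1) * (q + 1)) = (int s - 1) * (int q + 1)" by (simp only: of_nat_mult of_nat_add of_nat_1)
  then have k_large: "(s - 1) * (q + 1) \<le> k" using assms(7) by linarith
  have "int (s * (q + 1)) = int s * (int q + 1)" by (simp only: of_nat_mult of_nat_add of_nat_1)
  then have n_large: "s * (q + 1) + k \<le> n + 2" using assms(8) by linarith
  have "1 \<le> s - 1" using s by linarith
  from mult_le_mono1[OF this, of "q + 1"] have q_le: "q + 1 \<le> (s - 1) * (q + 1)" unfolding mult_1 .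
  have k1: "s + 2 < k" using q_le k_large s assms(1) by linarith
  have sq: "s * (q + 1) = (s - 1) * (q + 1) + (q + 1)" using s by (cases s) auto
  have n_k: "k + 2 * q \<le> n" using n_large q_le sq by linarith
  obtain z where z: "z \<in> C" "z \<noteq> 0" using ex_nonzero_of_dim[of C] k by auto
  note min_C = min_distance_properties[OF C z]
  let ?D = "dual_code C"
  have D: "vec.subspace ?D" by (rule subspace_dual_code)
  have dim_D: "vec.dim ?D = n - k" using dim_dual_code[OF C] n k by simp
  have dim_D_pos: "0 < vec.dim ?D" using dim_D n_k s assms(1) by simp
  obtain z' where z': "z' \<in> ?D" "z' \<noteq> 0" using ex_nonzero_of_dim[OF dim_D_pos] by blast
  note min_D = min_distance_properties[OF D z']
  have lower: "k - 1 \<le> card {i. y $ i \<noteq> 0}" if y: "y \<in> ?D" "y \<noteq> 0" for y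
  proof -
    have "card {i. c $ i = 0} \<le> vec.dim C - 1 + s" if "c \<in> C" "c \<noteq> 0" for c
      using min_C(1)[OF that] card_zeros[of c] n d k dks by linarith
    then show ?thesis
      using dual_weight_ge_dim_minus_1[OF C _ _ _ s _ y] k n n_large k1 assms(1,6) by auto
  qed
  \<comment> \<open>Otherwise \<open>dual_weight_ge_dim\<close>, applied to the dual code with
    \<open>t = s - 1\<close>, would give every nonzero word of \<open>C\<close> weight at least
    \<open>n - k\<close>. A word of minimum weight has only \<open>n - k + 1 - s\<close>, which is
    smaller as \<open>1 < s\<close>.\<close>
  have upper: "\<exists>y\<in>?D. y \<noteq> 0 \<and> card {i. y $ i \<noteq> 0} \<le> k + 1 - s"
  proof (rule ccontr)
    assume neg: "\<not> ?thesis"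
    have zeros: "card {i. y $ i = 0} \<le> vec.dim ?D - 1 + (s - 1)" if "y \<in> ?D" "y \<noteq> 0" for y
    proof -
      have "\<not> card {i. y $ i \<noteq> 0} \<le> k + 1 - s" using neg that by blast
      then show ?thesis using card_zeros[of y] n dim_D k1 n_k s assms(1) by linarith
    qed
    obtain c where c: "c \<in> C" "c \<noteq> 0" "card {i. c $ i \<noteq> 0} = d" using min_C(2) d by auto
    have c_dual: "c \<in> dual_code ?D" using c subset_dual_dual by blast
    have "(s - 1) * (CARD('a) + 1) + vec.dim ?D \<le> CARD('n)"
      using k_large dim_D n n_k assms(1) by simp
    then have "vec.dim ?D \<le> card {i. c $ i \<noteq> 0}"
      using dual_weight_ge_dim[OF D dim_D_pos zeros _ c_dual c(2)] by blast
    then show False using c dim_D dks s n_k by linarith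
  qed
  have min_eq: "min_distance ?D = k + 1 - s"
  proof (rule antisym)
    obtain y where "y \<in> ?D" "y \<noteq> 0" "card {i. y $ i \<noteq> 0} \<le> k + 1 - s" using upper by blast
    then show "min_distance ?D \<le> k + 1 - s" using min_D(1) by fastforce
    obtain y' where "y' \<in> ?D" "y' \<noteq> 0" "card {i. y' $ i \<noteq> 0} = min_distance ?D" using min_D(2) by blast
    \<comment> \<open>The bound \<open>k - 1\<close> suffices because
      \<open>2 \<le> s\<close>.\<close>
    then show "k + 1 - s \<le> min_distance ?D" using lower[of y'] s by linarith
  qed
  \<comment> \<open>If all dual words vanished at \<open>i\<close>, the unit vector at
    \<open>i\<close> would lie in \<open>C\<close>, giving \<open>d \<le> 1\<close>; but
    \<open>d = n + 1 - k - s\<close> is at least \<open>s * q - 1\<close>.\<close>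
  have "nondegenerate ?D"
    unfolding nondegenerate_def
  proof (rule allI, rule ccontr)
    fix i assume neg: "\<not> (\<exists>y\<in>?D. y $ i \<noteq> 0)"
    have "(\<Sum>j\<in>UNIV. y $ j * axis i 1 $ j) = 0" if "y \<in> ?D" for y
      using sum_axis_mult[of i y] neg that by (simp add: mult.commute)
    then have "axis i 1 \<in> dual_code ?D" unfolding dual_code_def[of ?D] by blast
    then have "axis i 1 \<in> C" using dual_dual_code[OF C] by simp
    moreover have "axis i (1 :: 'a) \<noteq> 0" by (simp add: axis_eq_0_iff)
    moreover have "{j. axis i (1 :: 'a) $ j \<noteq> 0} = {i}" by (auto simp: axis_def)
    ultimately have "d \<le> 1" using min_C(1)[of "axis i 1"] d by simp
    then show False using dks n_large sq q_le s assms(1) by linarith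
  qed
  then have "nkd_code n (n - k) (k + 1 - s) ?D"
    unfolding nkd_code_def using D n dim_D dim_D_pos min_eq by simp
  moreover have "int n - int (n - k) + 1 - int (k + 1 - s) = int s" using n_k k1 by simp
  ultimately have "AsMDS s ?D" unfolding AsMDS_def by blast
  then show ?thesis using assms(3) by (simp add: NsMDS_def)
qed

end
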